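(* Let $L=L_0\oplus L_1$ be a complex nilpotent Leibniz superalgebra with $\dim L_0=n$ and $\dim L_1=m$, and suppose its characteristic sequence is $(n_1,\dots,n_k\mid m_1,\dots,m_s)$ (so $n_1+\dots+n_k=n$ and $m_1+\dots+m_s=m$), where $n_1\le n-2$ and $m_1\le m-1$. Then the nilindex of $L$ is strictly less than $n+m$.
   Context: All spaces are finite-dimensional over $\mathbb{C}$. A Leibniz superalgebra is a $\mathbb{Z}_2$-graded vector space $L=L_0\oplus L_1$ with a bilinear product $[-,-]$ such that $[L_\alpha,L_\beta]\subseteq L_{\alpha+\beta \,(\mathrm{mod}\ 2)}$ and $$[x,[y,z]]=[[x,y],z]-(-1)^{\alpha\beta}[[x,z],y]$$ for all $x\in L$, $y\in L_\alpha$, $z\in L_\beta$, $\alpha,\beta\in\mathbb{Z}_2$. No (super-)antisymmetry is assumed. The even part $L_0$ is a Leibniz algebra. Descending central sequence: $L^1=L$, $L^{k+1}=[L^k,L]$ (linear span of products) for $k\ge1$. $L$ is nilpotent if $L^s=0$ for some $s\in\mathbb{N}$; the minimal such $s$ is the nilindex of $L$. $L_0^2=[L_0,L_0]$ denotes the second term of the descending central sequence of the Leibniz algebra $L_0$. Characteristic sequence: for $L$ nilpotent and $x\in L_0$, the right multiplication $R_x(y)=[y,x]$ restricts to a nilpotent endomorphism of $L_i$ for $i\in\{0,1\}$. Let $C_i(x)$ be the sequence of sizes of the Jordan blocks of $R_x|_{L_i}$, arranged in descending order. Such sequences are compared lexicographically. The characteristic sequence of $L$ is $$C(L)=\left(\max_{x\in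 L_0\setminus L_0^2}C_0(x)\ \Big|\ \max_{\widetilde x\in L_0\setminus L_0^2}C_1(\widetilde x)\right),$$ where the two maxima are taken independently of each other. *)

theory Defs
  imports Complex_Main "Jordan_Normal_Form.Jordan_Normal_Form"
begin

(* The underlying space is the whole type 'a with an explicit complex scalar multiplication;
   the homogeneous parts are L 0 and L 1 (the values of L at other indices are irrelevant). *)
locale leibniz_superalgebra = vector_space scale
  for scale :: "complex \<Rightarrow> 'a::ab_group_add \<Rightarrow> 'a" +
  fixes L :: "nat \<Rightarrow> 'a set"
    and br :: "'a \<Rightarrow> 'a \<Rightarrow> 'a"
  assumes finite_dimensional: "\<exists>B. finite B \<and> span B = UNIV"
    and subspace_L: "\<alpha> \<in> {0, 1} \<Longrightarrow> subspace (L \<alpha>)"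
    and L_inter: "L 0 \<inter> L 1 = {0}"
    and L_sum: "\<exists>a\<in>L 0. \<exists>b\<in>L 1. x = a + b"
    and linear_left: "Vector_Spaces.linear scale scale (\<lambda>x. br x y)"
    and linear_right: "Vector_Spaces.linear scale scale (\<lambda>y. br x y)"
    and graded: "\<lbrakk>\<alpha> \<in> {0, 1}; \<beta> \<in> {0, 1}; x \<in> L \<alpha>; y \<in> L \<beta>\<rbrakk>
      \<Longrightarrow> br x y \<in> L ((\<alpha> + \<beta>) mod 2)"
    and leibniz: "\<lbrakk>\<alpha> \<in> {0, 1}; \<beta> \<in> {0, 1}; y \<in> L \<alpha>; z \<in> L \<beta>\<rbrakk>
      \<Longrightarrow> br x (br y z) = br (br x y) z - scale ((-1) ^ (\<alpha> * \<beta>)) (br (br x z) y)"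
begin

definition bracket_span :: "'a set \<Rightarrow> 'a set \<Rightarrow> 'a set" where
  "bracket_span A B = span {br a b | a b. a \<in> A \<and> b \<in> B}"

(* Indexed as V^1 = V, V^(k+1) = [V^k, V]; only indices k >= 1 are meaningful. *)
definition desc_central :: "'a set \<Rightarrow> nat \<Rightarrow> 'a set" where
  "desc_central V k = ((\<lambda>A. bracket_span A V) ^^ (k - 1)) V"

definition nilpotent :: bool where
  "nilpotent \<longleftrightarrow> (\<exists>s\<ge>1. desc_central UNIV s = {0})"

definition nilindex :: nat where
  "nilindex = (LEAST s. 1 \<le> s \<and> desc_central UNIV s = {0})"

definition ordered_basis :: "'a list \<Rightarrow> 'a set \<Rightarrow> bool" where
  "ordered_basis bs V \<longleftrightarrow> distinct bs \<and> independent (set bs) \<and> span (set bs) = V"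

(* Column j holds the coordinates of f (bs ! j). *)
definition matrix_wrt :: "'a list \<Rightarrow> ('a \<Rightarrow> 'a) \<Rightarrow> complex mat" where
  "matrix_wrt bs f =
    mat (length bs) (length bs) (\<lambda>(i, j). representation (set bs) (f (bs ! j)) (bs ! i))"

(* ns lists the sizes of the Jordan blocks of f restricted to the f-invariant subspace V. *)
definition jordan_sizes :: "('a \<Rightarrow> 'a) \<Rightarrow> 'a set \<Rightarrow> nat list \<Rightarrow> bool" where
  "jordan_sizes f V ns \<longleftrightarrow>
    (\<exists>bs n_as. ordered_basis bs V \<and> jordan_nf (matrix_wrt bs f) n_as \<and>
      ns = rev (sort (map fst n_as)))"

definition right_mult :: "'a \<Rightarrow> 'a \<Rightarrow> 'a" where
  "right_mult x y = br y x"

definition block_sequences :: "nat \<Rightarrow> nat list set" where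
  "block_sequences i =
    {ns. \<exists>x\<in>L 0 - desc_central (L 0) 2. jordan_sizes (right_mult x) (L i) ns}"

definition is_lex_max :: "nat list \<Rightarrow> nat list set \<Rightarrow> bool" where
  "is_lex_max ns A \<longleftrightarrow> ns \<in> A \<and> (\<forall>ks\<in>A. ks = ns \<or> (ks, ns) \<in> lexord less_than)"

definition has_char_seq :: "nat list \<Rightarrow> nat list \<Rightarrow> bool" where
  "has_char_seq ns ms \<longleftrightarrow>
    is_lex_max ns (block_sequences 0) \<and> is_lex_max ms (block_sequences 1)"

end

end

theory Submission
  imports Defs "Jordan_Normal_Form.Jordan_Normal_Form_Existence"
begin

text \<open>
  Write \<open>N = n + m\<close> and \<open>L\<^sup>k\<close> for the terms of the descending central sequence, and suppose
  that the nilindex is at least \<open>N\<close>.  The sequence then has at least \<open>N - 1\<close> nonzero terms in a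
  space of dimension \<open>N\<close>, so there is room for at most one quotient \<open>L\<^sup>k / L\<^sup>k\<^sup>+\<^sup>1\<close> of dimension
  two: either \<open>L\<close> is generated by one element, or it is generated by two homogeneous elements \<open>x\<close>,
  \<open>y\<close> and all later quotients have dimension at most one.  In the second case each nonzero
  \<open>L\<^sup>k / L\<^sup>k\<^sup>+\<^sup>1\<close> with \<open>k \<ge> 2\<close> has a parity, and by parity at most one of \<open>R\<^sub>x\<close> and \<open>R\<^sub>y\<close> acts on it
  nontrivially when the parities of \<open>x\<close> and \<open>y\<close> differ.

  The characteristic sequence enters only through its first blocks.  Since Jordan blocks are
  nonempty, the hypotheses give \<open>n \<ge> 3\<close> and \<open>m \<ge> 2\<close>, and since \<open>n\<^sub>1\<close> bounds all block sizes,
  \<open>R\<^sub>u\<^sup>n\<^sup>-\<^sup>2\<close> vanishes on \<open>L\<^sub>0\<close> for every \<open>u\<close> in \<open>L\<^sub>0\<close> outside \<open>[L\<^sub>0, L\<^sub>0]\<close>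
  (\<open>pow_first_block_zero\<close>).

  An odd generator \<open>x\<close> exists, for otherwise \<open>L\<^sub>1 = 0\<close>.  If the quotients from \<open>L\<^sup>2\<close> on have
  alternating parity, starting with an even one, and a single odd element \<open>a\<close> carries each quotient
  onto the next, then \<open>u = [a, a]\<close> satisfies \<open>R\<^sub>u = 2 R\<^sub>a\<^sup>2\<close> and acts on the even quotients as one long
  Jordan block, which contradicts the vanishing of \<open>R\<^sub>u\<^sup>n\<^sup>-\<^sup>2\<close>
  (\<open>alternating_chain_contradiction\<close>).  This disposes of the case of one generator, of two odd
  generators (with \<open>a\<close> generic in their span), and, when \<open>y\<close> is even, of the case that \<open>L\<^sup>2 / L\<^sup>3\<close> is
  even: there \<open>R\<^sub>x\<close> and \<open>R\<^sub>y\<close> commute up to higher order, so that the same one of them acts at every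
  step, and if it is \<open>R\<^sub>y\<close> then \<open>m = 1\<close>.

  There remains the case of \<open>x\<close> odd, \<open>y\<close> even and \<open>L\<^sup>2 / L\<^sup>3\<close> odd.  Let \<open>k\<close> be the first degree, at least
  two, with an even quotient \<open>L\<^sup>k / L\<^sup>k\<^sup>+\<^sup>1\<close>.  The sequence cannot continue past it: if \<open>[x, y]\<close> lies
  in \<open>L\<^sup>3\<close> then \<open>R\<^sub>x\<close> and \<open>R\<^sub>y\<close> again commute up to higher order, and otherwise this follows by
  evaluating \<open>[x, R\<^sub>y\<^sup>k\<^sup>-\<^sup>1 x]\<close> in two ways (\<open>mixed_word_calculation\<close>).  Hence \<open>n \<le> 2\<close>.
\<close>

section \<open>Nilpotent operators and their Jordan blocks\<close>

text \<open>A nilpotent matrix has zero as its only eigenvalue, so each block of its Jordan form is a shift and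
  dies at the power given by its size.\<close>

lemma jordan_nf_nilpotent_pow_zero:
  fixes A :: "complex mat"
  assumes A: "A \<in> carrier_mat n n"
    and nil: "A ^\<^sub>m M = 0\<^sub>m n n"
    and jnf: "jordan_nf A n_as"
    and bound: "\<And>k a. (k, a) \<in> set n_as \<Longrightarrow> k \<le> t"
  shows "A ^\<^sub>m t = 0\<^sub>m n n"
proof -
  have blocks: "jordan_block k a ^\<^sub>m t = 0\<^sub>m k k" if ka: "(k, a) \<in> set n_as" for k a
  proof -
    have "k \<noteq> 0" using jnf ka unfolding jordan_nf_def by force
    have cp: "char_poly A = (\<Prod>(k, a)\<leftarrow>n_as. [:- a, 1:] ^ k)"
      by (rule jordan_nf_char_poly[OF jnf])
    have "poly (char_poly A) a = 0"
      unfolding cp using ka \<open>k \<noteq> 0\<close>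
      by (induct n_as) (auto simp: poly_power)
    then have "eigenvalue A a"
      using eigenvalue_root_char_poly[OF A] by simp
    then obtain v where v: "eigenvector A v a" unfolding eigenvalue_def by blast
    then have vc: "v \<in> carrier_vec n" and v0: "v \<noteq> 0\<^sub>v n"
      using A unfolding eigenvector_def by auto
    have "0\<^sub>m n n *\<^sub>v v = a ^ M \<cdot>\<^sub>v v"
      using eigenvector_pow[OF A v, of M] nil by simp
    moreover have "0\<^sub>m n n *\<^sub>v v = 0\<^sub>v n"
      using vc by (intro eq_vecI) (auto simp: scalar_prod_def)
    ultimately have "a ^ M \<cdot>\<^sub>v v = 0\<^sub>v n" by simp
    moreover obtain i where "i < n" "v $ i \<noteq> 0"
      using v0 vc by (metis carrier_vecD eq_vecI index_zero_vec(1) index_zero_vec(2))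
    ultimately have "a ^ M = 0"
      by (metis carrier_vecD index_smult_vec(1) index_zero_vec(1) mult_eq_0_iff vc)
    then have "a = 0" by simp
    then show ?thesis
      using bound[OF ka] by (intro eq_matI) (auto simp: jordan_block_zero_pow)
  qed
  obtain P Q where P: "P \<in> carrier_mat n n" and Q: "Q \<in> carrier_mat n n"
    and pow: "\<And>k. A ^\<^sub>m k = P * (jordan_matrix n_as) ^\<^sub>m k * Q"
    using jordan_nf_powE[OF A jnf] by metis
  obtain P' Q' where wit: "similar_mat_wit A (jordan_matrix n_as) P' Q'"
    using jnf unfolding jordan_nf_def similar_mat_def by blast
  have J: "jordan_matrix n_as \<in> carrier_mat n n"
    using similar_mat_witD2[OF A wit] by simp
  have "jordan_matrix n_as ^\<^sub>m t = 0\<^sub>m n n"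
  proof (rule eq_matI)
    fix i j assume ij: "i < dim_row (0\<^sub>m n n :: complex mat)" "j < dim_col (0\<^sub>m n n :: complex mat)"
    let ?Jt = "jordan_matrix n_as ^\<^sub>m t"
    have "?Jt $$ (i, j) \<in> elements_mat ?Jt"
      using ij J by (intro elements_matI[of _ n n i j]) auto
    also have "\<dots> \<subseteq> {0} \<union> \<Union> (set (map elements_mat (map (\<lambda>(n,a). (jordan_block n a) ^\<^sub>m t) n_as)))"
      unfolding jordan_matrix_pow by (rule elements_diag_block_mat)
    also have "\<dots> \<subseteq> {0}"
      using blocks by (auto dest!: elements_matD)
    finally show "?Jt $$ (i, j) = 0\<^sub>m n n $$ (i, j)" using ij by simp
  qed (use J in auto)
  then show ?thesis using pow[of t] P Q by simp
qed

context leibniz_superalgebra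
begin

lemma matrix_wrt_carrier: "matrix_wrt bs f \<in> carrier_mat (length bs) (length bs)"
  by (simp add: matrix_wrt_def)

lemma matrix_wrt_comp:
  assumes bs: "ordered_basis bs V"
    and f: "Vector_Spaces.linear scale scale f"
    and g: "g ` V \<subseteq> V" and fV: "f ` V \<subseteq> V"
  shows "matrix_wrt bs (f \<circ> g) = matrix_wrt bs f * matrix_wrt bs g"
proof (rule eq_matI)
  fix i j assume "i < dim_row (matrix_wrt bs f * matrix_wrt bs g)"
    "j < dim_col (matrix_wrt bs f * matrix_wrt bs g)"
  then have ij: "i < length bs" "j < length bs" by (auto simp: matrix_wrt_def)
  interpret f: Vector_Spaces.linear scale scale f by (rule f)
  let ?B = "set bs"
  have ind: "independent ?B" and sp: "span ?B = V" and dist: "distinct bs"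
    using bs by (auto simp: ordered_basis_def)
  have mem: "bs ! l \<in> V" if "l < length bs" for l
    using that sp by (metis (no_types) nth_mem span_base)
  let ?v = "g (bs ! j)"
  have v: "?v \<in> span ?B" using g mem ij sp by blast
  have "?v = (\<Sum>b\<in>?B. scale (representation ?B ?v b) b)"
    using sum_representation_eq[OF ind v] by simp
  then have "f ?v = f (\<Sum>b\<in>?B. scale (representation ?B ?v b) b)" by (rule arg_cong)
  also have "\<dots> = (\<Sum>b\<in>?B. scale (representation ?B ?v b) (f b))"
    by (simp add: f.sum f.scale)
  finally have "representation ?B (f ?v) (bs ! i) =
      representation ?B (\<Sum>b\<in>?B. scale (representation ?B ?v b) (f b)) (bs ! i)" by simp
  also have "\<dots> = (\<Sum>b\<in>?B. representation ?B (scale (representation ?B ?v b) (f b)) (bs ! i))"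
  proof (subst representation_sum[OF ind])
    fix b assume "b \<in> ?B"
    then show "scale (representation ?B ?v b) (f b) \<in> span ?B"
      using fV sp by (meson image_subset_iff span_base span_scale)
  qed simp
  also have "\<dots> = (\<Sum>b\<in>?B. representation ?B ?v b * representation ?B (f b) (bs ! i))"
  proof (rule sum.cong[OF refl])
    fix b assume "b \<in> ?B"
    then have "f b \<in> span ?B" using fV sp by (meson image_subset_iff span_base)
    then show "representation ?B (scale (representation ?B ?v b) (f b)) (bs ! i)
      = representation ?B ?v b * representation ?B (f b) (bs ! i)"
      by (simp add: representation_scale[OF ind])
  qed
  also have "\<dots> = (\<Sum>l<length bs. representation ?B ?v (bs!l) * representation ?B (f (bs!l)) (bs ! i))"
    by (rule sum.reindex_bij_betw[symmetric], rule bij_betw_nth[OF dist]) auto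
  finally show "matrix_wrt bs (f \<circ> g) $$ (i, j) = (matrix_wrt bs f * matrix_wrt bs g) $$ (i, j)"
    using ij by (simp add: matrix_wrt_def scalar_prod_def lessThan_atLeast0 mult.commute)
qed (simp_all add: matrix_wrt_def)

lemma linear_funpow:
  assumes f: "Vector_Spaces.linear scale scale f"
  shows "Vector_Spaces.linear scale scale (f ^^ k)"
proof (induct k)
  case 0
  show ?case using linear_id by (simp add: id_def)
next
  case (Suc k)
  show ?case using Vector_Spaces.linear_compose[OF Suc f] by (simp add: comp_def)
qed

lemma matrix_wrt_pow:
  assumes bs: "ordered_basis bs V"
    and f: "Vector_Spaces.linear scale scale f" and fV: "f ` V \<subseteq> V"
  shows "matrix_wrt bs (f ^^ k) = matrix_wrt bs f ^\<^sub>m k"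
proof (induct k)
  case 0
  have "matrix_wrt bs id = 1\<^sub>m (length bs)"
    using bs by (auto intro!: eq_matI simp: matrix_wrt_def ordered_basis_def representation_basis
        nth_eq_iff_index_eq)
  then show ?case by (simp add: matrix_wrt_def id_def)
next
  case (Suc k)
  have "(f ^^ k) ` V \<subseteq> V" using fV by (induct k) auto
  interpret f: Vector_Spaces.linear scale scale f by (rule f)
  have lk: "Vector_Spaces.linear scale scale (f ^^ k)"
    by (rule linear_funpow[OF f])
  have "matrix_wrt bs (f ^^ k \<circ> f) = matrix_wrt bs (f ^^ k) * matrix_wrt bs f"
    by (rule matrix_wrt_comp[OF bs lk]) (use fV \<open>(f ^^ k) ` V \<subseteq> V\<close> in auto)
  then show ?case using Suc by (simp only: funpow_Suc_right pow_mat.simps)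
qed

lemma matrix_wrt_zero_iff:
  assumes bs: "ordered_basis bs V"
    and f: "Vector_Spaces.linear scale scale f" and fV: "f ` V \<subseteq> V"
  shows "matrix_wrt bs f = 0\<^sub>m (length bs) (length bs) \<longleftrightarrow> (\<forall>v\<in>V. f v = 0)"
proof
  interpret f: Vector_Spaces.linear scale scale f by (rule f)
  let ?B = "set bs"
  have ind: "independent ?B" and sp: "span ?B = V"
    using bs by (auto simp: ordered_basis_def)
  assume z: "matrix_wrt bs f = 0\<^sub>m (length bs) (length bs)"
  have zero: "f b = 0" if b: "b \<in> ?B" for b
  proof -
    obtain j where j: "j < length bs" "b = bs ! j" using b by (auto simp: in_set_conv_nth)
    have "representation ?B (f b) c = 0" if c: "c \<in> ?B" for c
    proof -
      obtain i where i: "i < length bs" "c = bs ! i" using c by (metis in_set_conv_nth)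
      have "matrix_wrt bs f $$ (i, j) = 0" using z i j by simp
      then show ?thesis using i j by (simp add: matrix_wrt_def)
    qed
    moreover have "f b \<in> span ?B" using b fV sp by (meson image_subset_iff span_base)
    ultimately show ?thesis
      using sum_representation_eq[OF ind, of "f b" ?B] by simp
  qed
  show "\<forall>v\<in>V. f v = 0"
  proof
    fix v assume "v \<in> V"
    then have "v \<in> span ?B" using sp by simp
    then show "f v = 0"
      by (induct rule: span_induct_alt) (auto simp: f.add f.scale zero f.zero)
  qed
next
  assume z: "\<forall>v\<in>V. f v = 0"
  have mem: "bs ! l \<in> V" if "l < length bs" for l
    using that bs by (metis nth_mem ordered_basis_def span_base)
  show "matrix_wrt bs f = 0\<^sub>m (length bs) (length bs)"
    by (rule eq_matI) (use z mem in \<open>auto simp: matrix_wrt_def representation_zero\<close>)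
qed

lemma finite_dimensional_basis: "\<exists>B. finite_dimensional_vector_space scale B"
proof -
  obtain B where B: "finite B" "span B = UNIV" using finite_dimensional by blast
  obtain B' where B': "B' \<subseteq> B" "independent B'" "B \<subseteq> span B'"
    using maximal_independent_subset[of B] by blast
  have "span B' = UNIV" using B(2) B'(3) by (metis span_mono span_span top.extremum_uniqueI)
  moreover have "finite B'" using B(1) B'(1) by (rule rev_finite_subset)
  ultimately show ?thesis using B'(2)
    by (intro exI[of _ B']) (unfold_locales, auto)
qed

lemma ordered_basis_exists:
  assumes V: "subspace V"
  shows "\<exists>bs. ordered_basis bs V"
proof -
  obtain C where "finite_dimensional_vector_space scale C" using finite_dimensional_basis by blast
  then interpret fd: finite_dimensional_vector_space scale C .
  obtain B where B: "B \<subseteq> V" "independent B" "V \<subseteq> span B" by (metis basis_exists)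
  have "finite B" by (rule fd.finiteI_independent[OF B(2)])
  then obtain bs where "set bs = B" "distinct bs" using finite_distinct_list by blast
  moreover have "span B = V" by (rule antisym[OF span_minimal[OF B(1) V] B(3)])
  ultimately show ?thesis using B by (auto simp: ordered_basis_def)
qed

lemma block_sequence_pos:
  assumes "t # ks \<in> block_sequences i"
  shows "0 < t"
proof -
  obtain A :: "complex mat" and n_as where jnf: "jordan_nf A n_as" and eq: "t # ks = rev (sort (map fst n_as))"
    using assms unfolding block_sequences_def jordan_sizes_def by blast
  have "set (t # ks) = fst ` set n_as" unfolding eq by simp
  then have "t \<in> fst ` set n_as" by (metis list.set_intros(1))
  then show ?thesis using jnf unfolding jordan_nf_def by (metis neq0_conv)
qed

text \<open>Lexicographic maximality is used only for the first entry: the largest block of any admissible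
  right multiplication is at most \<open>t\<close>.\<close>

lemma pow_first_block_zero:
  assumes i: "i \<in> {0, 1}"
    and lm: "is_lex_max (t # ks) (block_sequences i)"
    and x: "x \<in> L 0 - desc_central (L 0) 2"
    and nil: "\<And>v. (right_mult x ^^ M) v = 0"
    and v: "v \<in> L i"
  shows "(right_mult x ^^ t) v = 0"
proof -
  let ?f = "right_mult x"
  have lin: "Vector_Spaces.linear scale scale ?f"
    using linear_left by (simp add: right_mult_def[abs_def])
  have fV: "?f ` L i \<subseteq> L i"
    using graded[of i 0 _ x] x i by (auto simp: right_mult_def)
  then have fVk: "(?f ^^ k) ` L i \<subseteq> L i" for k by (induct k) auto
  obtain bs where bs: "ordered_basis bs (L i)"
    using ordered_basis_exists[OF subspace_L[OF i]] by blast
  let ?A = "matrix_wrt bs ?f"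
  have A: "?A \<in> carrier_mat (length bs) (length bs)" by (rule matrix_wrt_carrier)
  have pow: "?A ^\<^sub>m k = 0\<^sub>m (length bs) (length bs) \<longleftrightarrow> (\<forall>v\<in>L i. (?f ^^ k) v = 0)" for k
    using matrix_wrt_pow[OF bs lin fV, of k]
      matrix_wrt_zero_iff[OF bs linear_funpow[OF lin, of k] fVk] by simp
  obtain n_as where jnf: "jordan_nf ?A n_as"
    using char_poly_factorized[OF A] jordan_nf_exists[OF A] by blast
  define ls where "ls = rev (sort (map fst n_as))"
  have "ls \<in> block_sequences i"
    using x bs jnf unfolding block_sequences_def jordan_sizes_def ls_def by blast
  then have "ls = t # ks \<or> (ls, t # ks) \<in> lexord less_than"
    using lm unfolding is_lex_max_def by blast
  then have hd: "ls = [] \<or> hd ls \<le> t"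
    by (cases ls) auto
  have sorted: "sorted (rev ls)" unfolding ls_def by simp
  have le: "k \<le> t" if "(k, a) \<in> set n_as" for k a
  proof -
    have "set ls = fst ` set n_as" unfolding ls_def by simp
    then have k: "k \<in> set ls" using that by force
    have "k \<le> hd ls"
      using k sorted by (cases ls) (auto simp: sorted_append)
    then show ?thesis using hd k by (cases ls) auto
  qed
  have "?A ^\<^sub>m t = 0\<^sub>m (length bs) (length bs)"
    by (rule jordan_nf_nilpotent_pow_zero[OF A _ jnf le]) (use pow[of M] nil in auto)
  then show ?thesis using pow[of t] v by simp
qed

section \<open>The filtration by the descending central sequence\<close>


abbreviation lcs :: "nat \<Rightarrow> 'a set" where
  "lcs k \<equiv> desc_central UNIV k"

lemma br_add_left: "br (a + b) c = br a c + br b c"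
  and br_scale_left: "br (scale r a) c = scale r (br a c)"
  and br_zero_left [simp]: "br 0 c = 0"
  and br_diff_left: "br (a - b) c = br a c - br b c"
proof -
  interpret f: Vector_Spaces.linear scale scale "\<lambda>x. br x c" by (rule linear_left)
  show "br (a + b) c = br a c + br b c" "br (scale r a) c = scale r (br a c)"
    "br 0 c = 0" "br (a - b) c = br a c - br b c"
    by (fact f.add f.scale f.zero f.diff)+
qed

lemma br_add_right: "br c (a + b) = br c a + br c b"
  and br_scale_right: "br c (scale r a) = scale r (br c a)"
  and br_zero_right [simp]: "br c 0 = 0"
  and br_diff_right: "br c (a - b) = br c a - br c b"
proof -
  interpret f: Vector_Spaces.linear scale scale "\<lambda>x. br c x" by (rule linear_right)
  show "br c (a + b) = br c a + br c b" "br c (scale r a) = scale r (br c a)"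
    "br c 0 = 0" "br c (a - b) = br c a - br c b"
    by (fact f.add f.scale f.zero f.diff)+
qed

lemma br_homogeneous:
  shows "a \<in> L 0 \<Longrightarrow> b \<in> L 0 \<Longrightarrow> br a b \<in> L 0"
    and "a \<in> L 1 \<Longrightarrow> b \<in> L 1 \<Longrightarrow> br a b \<in> L 0"
    and "a \<in> L 0 \<Longrightarrow> b \<in> L 1 \<Longrightarrow> br a b \<in> L 1"
    and "a \<in> L 1 \<Longrightarrow> b \<in> L 0 \<Longrightarrow> br a b \<in> L 1"
  using graded[of 0 0 a b] graded[of 1 1 a b] graded[of 0 1 a b] graded[of 1 0 a b] by auto

lemma leibniz_even_left:
  "y \<in> L 0 \<Longrightarrow> z \<in> L \<beta> \<Longrightarrow> \<beta> \<in> {0, 1} \<Longrightarrow> br x (br y z) = br (br x y) z - br (br x z) y"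
  using leibniz[of 0 \<beta> y z x] by simp

lemma leibniz_even_right:
  "y \<in> L \<alpha> \<Longrightarrow> z \<in> L 0 \<Longrightarrow> \<alpha> \<in> {0, 1} \<Longrightarrow> br x (br y z) = br (br x y) z - br (br x z) y"
  using leibniz[of \<alpha> 0 y z x] by simp

lemma leibniz_odd:
  "y \<in> L 1 \<Longrightarrow> z \<in> L 1 \<Longrightarrow> br x (br y z) = br (br x y) z + br (br x z) y"
  using leibniz[of 1 1 y z x] by simp

lemma lcs_1 [simp]: "lcs (Suc 0) = UNIV"
  by (simp add: desc_central_def)

lemma lcs_Suc: "1 \<le> k \<Longrightarrow> lcs (Suc k) = span {br a b | a b. a \<in> lcs k}"
  by (cases k) (auto simp: desc_central_def bracket_span_def)

lemma subspace_lcs: "subspace (lcs k)"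
  by (cases k; cases "k - 1") (auto simp: desc_central_def bracket_span_def)

lemma lcs_zero [simp]: "0 \<in> lcs k"
  by (rule subspace_0[OF subspace_lcs])

lemma lcs_add: "a \<in> lcs k \<Longrightarrow> b \<in> lcs k \<Longrightarrow> a + b \<in> lcs k"
  by (rule subspace_add[OF subspace_lcs])

lemma lcs_diff: "a \<in> lcs k \<Longrightarrow> b \<in> lcs k \<Longrightarrow> a - b \<in> lcs k"
  by (rule subspace_diff[OF subspace_lcs])

lemma lcs_scale: "a \<in> lcs k \<Longrightarrow> scale r a \<in> lcs k"
  by (rule subspace_scale[OF subspace_lcs])

lemma lcs_scale_iff: "r \<noteq> 0 \<Longrightarrow> scale r a \<in> lcs k \<longleftrightarrow> a \<in> lcs k"
  using lcs_scale[of "scale r a" k "inverse r"] lcs_scale[of a k r] by auto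

lemma br_lcs: "1 \<le> k \<Longrightarrow> a \<in> lcs k \<Longrightarrow> br a b \<in> lcs (Suc k)"
  unfolding lcs_Suc by (blast intro: span_base)

lemma lcs_Suc_subset: "lcs (Suc k) \<subseteq> lcs k"
proof (induct k)
  case 0
  then show ?case by (simp add: desc_central_def)
next
  case (Suc k)
  show ?case
  proof (cases "k = 0")
    case False
    then show ?thesis using Suc by (simp add: lcs_Suc) (rule span_mono, blast)
  qed simp
qed

lemma lcs_antimono: "i \<le> j \<Longrightarrow> lcs j \<subseteq> lcs i"
  by (rule lift_Suc_antimono_le[of lcs]) (rule lcs_Suc_subset)

lemma lcs_mono_mem: "a \<in> lcs j \<Longrightarrow> i \<le> j \<Longrightarrow> a \<in> lcs i"
  using lcs_antimono by blast

text \<open>The terms of the sequence are graded subspaces, because brackets of homogeneous elements span.\<close>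

lemma lcs_homogeneous_parts:
  "v \<in> lcs k \<Longrightarrow> \<exists>a\<in>L 0 \<inter> lcs k. \<exists>b\<in>L 1 \<inter> lcs k. v = a + b"
proof (induct k arbitrary: v)
  case 0
  then show ?case using L_sum[of v] by (simp add: desc_central_def)
next
  case (Suc k)
  show ?case
  proof (cases "k = 0")
    case True
    then show ?thesis using L_sum[of v] by simp
  next
    case False
    then have k: "1 \<le> k" by simp
    from Suc.prems have "v \<in> span {br a b | a b. a \<in> lcs k}" using k by (simp add: lcs_Suc)
    then show ?thesis
    proof (induct rule: span_induct_alt)
      case base
      show ?case using subspace_0[OF subspace_L] by (intro bexI[of _ 0]) auto
    next
      case (step c g w)
      then obtain a b where g: "g = br a b" and a: "a \<in> lcs k" by blast
      obtain a0 a1 where a01: "a0 \<in> L 0" "a0 \<in> lcs k" "a1 \<in> L 1" "a1 \<in> lcs k" "a = a0 + a1"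
        using Suc.hyps[OF a] by blast
      obtain b0 b1 where b01: "b0 \<in> L 0" "b1 \<in> L 1" "b = b0 + b1" using L_sum by blast
      obtain w0 w1 where w: "w0 \<in> L 0" "w0 \<in> lcs (Suc k)" "w1 \<in> L 1" "w1 \<in> lcs (Suc k)"
        "w = w0 + w1" using step by blast
      let ?e = "scale c (br a0 b0 + br a1 b1) + w0" and ?o = "scale c (br a0 b1 + br a1 b0) + w1"
      have "scale c g + w = ?e + ?o"
        unfolding g a01(5) b01(3) w(5) br_add_left br_add_right scale_right_distrib
        by (simp only: add_ac)
      moreover have "?e \<in> L 0" "?o \<in> L 1"
        by (intro subspace_add[OF subspace_L] subspace_scale[OF subspace_L] br_homogeneous a01 b01 w;
            simp)+
      moreover have "?e \<in> lcs (Suc k)" "?o \<in> lcs (Suc k)"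
        using a01 w br_lcs[OF k] by (auto intro!: lcs_add lcs_scale)
      ultimately show ?case by blast
    qed
  qed
qed

text \<open>The form in which gradedness of the terms is used: elements of different parity cannot cancel
  modulo a graded subspace.\<close>

lemma parity_separation:
  assumes pq: "p \<in> {0, 1}" "q \<in> {0, 1}" "p \<noteq> q"
    and v: "v \<in> L p" and u: "u \<in> L q" and d: "v - u \<in> lcs k"
  shows "v \<in> lcs k" and "u \<in> lcs k"
proof -
  obtain w0 w1 where w: "w0 \<in> L p" "w0 \<in> lcs k" "w1 \<in> L q" "w1 \<in> lcs k" "v - u = w0 + w1"
    using lcs_homogeneous_parts[OF d] pq by (auto simp: add.commute)
  have eq: "v - w0 = u + w1" using w(5) by (simp add: algebra_simps)
  moreover have "v - w0 \<in> L p" using v w pq by (intro subspace_diff[OF subspace_L]) auto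
  moreover have "u + w1 \<in> L q" using u w pq by (intro subspace_add[OF subspace_L]) auto
  ultimately have "v - w0 = 0" "u + w1 = 0" using L_inter pq by auto
  then have "v = w0" "u = - w1" by (auto simp: eq_neg_iff_add_eq_0)
  then show "v \<in> lcs k" "u \<in> lcs k" using w subspace_neg[OF subspace_lcs] by auto
qed

text \<open>By the Leibniz identity, right multiplication by \<open>[p, q]\<close> is a combination of \<open>R\<^sub>q R\<^sub>p\<close> and
  \<open>R\<^sub>p R\<^sub>q\<close>.  Hence a right factor from the \<open>j\<close>-th term raises the degree by \<open>j\<close>, although the sequence
  is defined by right multiplications from the whole space only.\<close>

lemma br_lcs_lcs: "1 \<le> i \<Longrightarrow> 1 \<le> j \<Longrightarrow> a \<in> lcs i \<Longrightarrow> b \<in> lcs j \<Longrightarrow> br a b \<in> lcs (i + j)"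
proof (induct j arbitrary: i a b)
  case 0
  then show ?case by simp
next
  case (Suc j)
  show ?case
  proof (cases "j = 0")
    case True
    then show ?thesis using Suc br_lcs by simp
  next
    case False
    then have j: "1 \<le> j" by simp
    from Suc.prems have "b \<in> span {br p q | p q. p \<in> lcs j}" using j by (simp add: lcs_Suc)
    then show ?thesis
    proof (induct rule: span_induct_alt)
      case base
      then show ?case by simp
    next
      case (step c g w)
      then obtain p q where g: "g = br p q" and p: "p \<in> lcs j" by blast
      have t1: "br (br a s) t \<in> lcs (i + Suc j)" if "s \<in> lcs j" for s t
        using br_lcs[of "i + j" "br a s" t] Suc.hyps[OF Suc.prems(1) j Suc.prems(3) that] j by simp
      have t2: "br (br a t) s \<in> lcs (i + Suc j)" if "s \<in> lcs j" for s t
        using Suc.hyps[of "Suc i" "br a t" s] j that br_lcs[OF Suc.prems(1,3)] by simp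
      have hom: "br a (br s t) \<in> lcs (i + Suc j)"
        if "s \<in> L \<alpha>" "\<alpha> \<in> {0,1}" "t \<in> L \<beta>" "\<beta> \<in> {0,1}" "s \<in> lcs j" for s t \<alpha> \<beta>
        using leibniz[of \<alpha> \<beta> s t a] that t1 t2 by (simp add: lcs_diff lcs_scale)
      obtain p0 p1 where p01: "p0 \<in> L 0" "p0 \<in> lcs j" "p1 \<in> L 1" "p1 \<in> lcs j" "p = p0 + p1"
        using lcs_homogeneous_parts[OF p] by blast
      obtain q0 q1 where q01: "q0 \<in> L 0" "q1 \<in> L 1" "q = q0 + q1" using L_sum by blast
      have "br a g \<in> lcs (i + Suc j)"
        unfolding g p01(5) q01(3) br_add_left br_add_right
        using hom[of p0 0 q0 0] hom[of p0 0 q1 1] hom[of p1 1 q0 0] hom[of p1 1 q1 1] p01 q01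
        by (auto intro!: lcs_add)
      then show ?case using step(2)
        by (simp add: br_add_right br_scale_right lcs_add lcs_scale)
    qed
  qed
qed

lemma lcs_stationary_zero:
  assumes nil: nilpotent and k: "1 \<le> k" and st: "lcs k \<subseteq> lcs (Suc k)"
  shows "lcs k = {0}"
proof -
  have step: "lcs (k + j) \<subseteq> lcs (Suc (k + j))" for j
  proof (induct j)
    case 0
    then show ?case using st by simp
  next
    case (Suc j)
    have "1 \<le> Suc (k + j)" "1 \<le> k + j" using k by auto
    then show ?case using Suc lcs_Suc[of "k + j"] lcs_Suc[of "Suc (k + j)"]
      by (simp, intro span_mono, blast)
  qed
  have all: "lcs k \<subseteq> lcs (k + j)" for j
    by (induct j) (use step in auto)
  obtain s where s: "lcs s = {0}" using nil unfolding nilpotent_def by blast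
  have "lcs k \<subseteq> lcs (k + s)" by (rule all)
  also have "\<dots> \<subseteq> lcs s" by (rule lcs_antimono) simp
  finally show ?thesis using s lcs_zero by blast
qed

lemma in_span_insert_lcs: "v \<in> span (insert g (lcs k)) \<longleftrightarrow> (\<exists>c. v - scale c g \<in> lcs k)"
  unfolding span_breakdown_eq span_eq_iff[THEN iffD2, OF subspace_lcs] ..

text \<open>Modulo higher terms a bracket depends only on the classes of its factors, and right factors from
  \<open>lcs 2\<close> raise the degree by two.  So the two generators alone carry a term of the sequence to the
  next.\<close>

lemma lcs_Suc_generators:
  assumes gen: "\<And>v. \<exists>c d. v - scale c x - scale d y \<in> lcs 2"
    and k: "1 \<le> k" and g: "lcs k \<subseteq> span (insert g (lcs (Suc k)))"
  shows "lcs (Suc k) \<subseteq> span (insert (br g x) (insert (br g y) (lcs (Suc (Suc k)))))"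
    (is "_ \<subseteq> span ?S")
proof -
  have "br a b \<in> span ?S" if a: "a \<in> lcs k" for a b
  proof -
    obtain c where c: "a - scale c g \<in> lcs (Suc k)"
      using g a in_span_insert_lcs by blast
    obtain d e where de: "b - scale d x - scale e y \<in> lcs 2" using gen by blast
    let ?b = "b - scale d x - scale e y"
    have eq: "br a b = br (a - scale c g) b + scale c (br g ?b)
        + scale c (scale d (br g x)) + scale c (scale e (br g y))"
      by (simp add: br_diff_left br_diff_right br_scale_left br_scale_right scale_right_diff_distrib)
    have gk: "br g ?b \<in> lcs (Suc (Suc k))" if "g \<in> lcs k"
      using br_lcs_lcs[of k 2 g ?b] that de k by simp
    have m1: "br (a - scale c g) b \<in> lcs (Suc (Suc k))" using br_lcs[of "Suc k"] c by simp
    have m2: "scale c (br g ?b) \<in> lcs (Suc (Suc k))"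
    proof (cases "c = 0")
      case False
      have "scale c g \<in> lcs k"
        using lcs_diff[OF a lcs_mono_mem[OF c, of k]] by simp
      then show ?thesis using False gk lcs_scale lcs_scale_iff by blast
    qed simp
    show ?thesis unfolding eq
      by (intro span_add span_scale span_base) (use m1 m2 span_base in auto)
  qed
  then have "span {br a b | a b. a \<in> lcs k} \<subseteq> span ?S"
    by (intro span_minimal) auto
  then show ?thesis using lcs_Suc[OF k] by simp
qed

text \<open>
  From degree two on, all quotients of successive terms have dimension at most one.  The condition
  is phrased with spans so that it can be applied to any chosen representative \<open>g\<close>.\<close>

definition thin :: bool where
  "thin \<longleftrightarrow> (\<forall>k\<ge>2. \<forall>g\<in>lcs k - lcs (Suc k). lcs k \<subseteq> span (insert g (lcs (Suc k))))"

lemma thinD: "thin \<Longrightarrow> 2 \<le> k \<Longrightarrow> g \<in> lcs k \<Longrightarrow> g \<notin> lcs (Suc k) \<Longrightarrow> lcs k \<subseteq> span (insert g (lcs (Suc k)))"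
  unfolding thin_def by blast

text \<open>A one-dimensional graded quotient has a single parity.\<close>

lemma thin_parity:
  assumes "thin" "2 \<le> k" "g \<in> lcs k" "g \<notin> lcs (Suc k)" "g \<in> L p" "u \<in> lcs k" "u \<in> L q"
    "p \<in> {0, 1}" "q \<in> {0, 1}" "p \<noteq> q"
  shows "u \<in> lcs (Suc k)"
proof -
  obtain c where c: "u - scale c g \<in> lcs (Suc k)"
    using thinD[OF assms(1-4)] assms(6) in_span_insert_lcs by blast
  show ?thesis
    by (rule parity_separation(1)[of q p u "scale c g"])
      (use assms c in \<open>auto intro: subspace_scale[OF subspace_L]\<close>)
qed

section \<open>Dimensions of the terms when the nilindex is large\<close>


lemma lcs_2_generators:
  assumes gen: "\<And>v. \<exists>c d. v - scale c x - scale d y \<in> lcs 2"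
  shows "lcs 2 \<subseteq> span ({br x x, br x y, br y x, br y y} \<union> lcs 3)" (is "_ \<subseteq> span ?S")
proof -
  have "br a b \<in> span ?S" for a b
  proof -
    obtain c d where cd: "a - scale c x - scale d y \<in> lcs 2" (is "?a \<in> _") using gen by blast
    obtain e h where eh: "b - scale e x - scale h y \<in> lcs 2" (is "?b \<in> _") using gen by blast
    have a: "br ?a b \<in> lcs 3" using br_lcs[of 2 ?a b] cd by (simp add: numeral_3_eq_3 numeral_2_eq_2)
    have b: "br t ?b \<in> lcs 3" for t
      using br_lcs_lcs[of 1 2 t ?b] eh by (simp add: numeral_3_eq_3 numeral_2_eq_2)
    have "br a b = br ?a b + scale c (br x ?b) + scale d (br y ?b)
        + scale c (scale e (br x x)) + scale c (scale h (br x y))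
        + scale d (scale e (br y x)) + scale d (scale h (br y y))"
      by (simp add: br_diff_left br_diff_right br_scale_left br_scale_right
          scale_right_diff_distrib)
    then show ?thesis
      using a b by (simp only:) (intro span_add span_scale span_base; simp)
  qed
  then have "span {br a b | a b. a \<in> lcs (Suc 0)} \<subseteq> span ?S"
    by (intro span_minimal) auto
  then show ?thesis using lcs_Suc[of "Suc 0"] by (simp add: numeral_2_eq_2)
qed

lemma dim_UNIV_le: "dim UNIV \<le> dim (L 0) + dim (L 1)"
proof -
  obtain C where "finite_dimensional_vector_space scale C" using finite_dimensional_basis by blast
  then interpret fd: finite_dimensional_vector_space scale C .
  obtain A where A: "A \<subseteq> L 0" "independent A" "L 0 \<subseteq> span A" "card A = dim (L 0)"
    by (metis basis_exists)
  obtain B where B: "B \<subseteq> L 1" "independent B" "L 1 \<subseteq> span B" "card B = dim (L 1)"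
    by (metis basis_exists)
  have fin: "finite (A \<union> B)"
    using fd.finiteI_independent A(2) B(2) by blast
  have "v \<in> span (A \<union> B)" for v
  proof -
    obtain a b where "a \<in> L 0" "b \<in> L 1" "v = a + b" using L_sum by blast
    then show ?thesis
      using A(3) B(3) span_mono[of A "A \<union> B"] span_mono[of B "A \<union> B"]
      by (auto intro!: span_add)
  qed
  then have "dim UNIV \<le> card (A \<union> B)" by (intro dim_le_card[OF _ fin]) auto
  also have "\<dots> \<le> card A + card B" by (rule card_Un_le)
  finally show ?thesis using A B by simp
qed

lemma dim_lcs_Suc_less:
  assumes nilpotent "1 \<le> k" "lcs k \<noteq> {0}"
  shows "dim (lcs (Suc k)) < dim (lcs k)"
proof -
  obtain C where "finite_dimensional_vector_space scale C" using finite_dimensional_basis by blast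
  then interpret fd: finite_dimensional_vector_space scale C .
  have "lcs (Suc k) \<subset> lcs k"
    using lcs_stationary_zero[OF assms(1,2)] assms(3) lcs_Suc_subset by blast
  then show ?thesis
    by (intro fd.dim_psubset) (simp add: span_eq_iff[THEN iffD2, OF subspace_lcs])
qed

text \<open>The terms before the nilindex decrease strictly, so each has at least the dimension forced by the
  number of nonzero terms after it.\<close>

lemma dim_lcs_lower:
  assumes nil: nilpotent and N: "N \<le> nilindex" and k: "1 \<le> k"
  shows "N \<le> k + dim (lcs k)"
proof (cases "N \<le> k")
  case False
  have nz: "lcs j \<noteq> {0}" if "1 \<le> j" "j < N" for j
    using not_less_Least[of j "\<lambda>s. 1 \<le> s \<and> lcs s = {0}"] that N unfolding nilindex_def by auto
  have "N \<le> (N - j) + dim (lcs (N - j))" if "j < N" for j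
    using that
  proof (induct j)
    case (Suc j)
    have "dim (lcs (Suc (N - Suc j))) < dim (lcs (N - Suc j))"
      by (rule dim_lcs_Suc_less[OF nil]) (use nz Suc in auto)
    moreover have "Suc (N - Suc j) = N - j" using Suc by simp
    ultimately show ?case using Suc by simp
  qed simp
  from this[of "N - k"] show ?thesis using k False by simp
qed simp

lemma dim_lcs_upper:
  assumes nil: nilpotent and d2: "dim (lcs 2) + 2 \<le> N" and k: "2 \<le> k"
  shows "lcs k = {0} \<or> dim (lcs k) + k \<le> N"
  using k
proof (induct k rule: dec_induct)
  case base
  then show ?case using d2 by simp
next
  case (step k)
  show ?case
  proof (cases "lcs k = {0}")
    case True
    then show ?thesis using lcs_Suc_subset[of k] lcs_zero[of "Suc k"] by blast
  next
    case False
    then show ?thesis using dim_lcs_Suc_less[OF nil _ False] step by simp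
  qed
qed

lemma dim_insert2:
  assumes "a \<notin> span S" "b \<notin> span (insert a S)"
  shows "dim (insert b (insert a S)) = dim S + 2"
proof -
  obtain C where "finite_dimensional_vector_space scale C" using finite_dimensional_basis by blast
  then interpret fd: finite_dimensional_vector_space scale C .
  show ?thesis using assms by (simp add: fd.dim_insert)
qed

lemma dim_mono_subset: "S \<subseteq> T \<Longrightarrow> dim S \<le> dim T"
proof -
  obtain C where "finite_dimensional_vector_space scale C" using finite_dimensional_basis by blast
  then interpret fd: finite_dimensional_vector_space scale C .
  show "S \<subseteq> T \<Longrightarrow> dim S \<le> dim T" by (rule fd.dim_subset)
qed

lemma span_lcs [simp]: "span (lcs k) = lcs k"
  using subspace_lcs span_eq_iff by blast

text \<open>The lower bound on \<open>dim (lcs (k + 1))\<close> from the length of the sequence and the upper bound on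
  \<open>dim (lcs k)\<close> from the loss of two dimensions in degree one differ by one.\<close>

lemma thin_if_large_nilindex:
  assumes nil: nilpotent and N: "N \<le> nilindex" and d2: "dim (lcs 2) + 2 \<le> N"
  shows thin
  unfolding thin_def
proof (intro allI impI ballI subsetI)
  fix k g v assume k: "2 \<le> k" and g: "g \<in> lcs k - lcs (Suc k)" and v: "v \<in> lcs k"
  show "v \<in> span (insert g (lcs (Suc k)))"
  proof (rule ccontr)
    assume "v \<notin> span (insert g (lcs (Suc k)))"
    then have "dim (lcs (Suc k)) + 2 = dim (insert v (insert g (lcs (Suc k))))"
      using g dim_insert2[of g "lcs (Suc k)" v] by simp
    also have "\<dots> \<le> dim (lcs k)"
      by (rule dim_mono_subset) (use g v lcs_Suc_subset[of k] in blast)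
    finally have "dim (lcs (Suc k)) + 2 \<le> dim (lcs k)" .
    moreover have "lcs k \<noteq> {0}" using g lcs_zero[of "Suc k"] by auto
    then have "dim (lcs k) + k \<le> N" using dim_lcs_upper[OF nil d2 k] by simp
    moreover have "N \<le> Suc k + dim (lcs (Suc k))" by (rule dim_lcs_lower[OF nil N]) simp
    ultimately show False by linarith
  qed
qed

text \<open>Without odd generators there are no odd elements: an odd bracket has an odd factor, so if the odd
  part lies in one term of the sequence then it lies in the next.\<close>

lemma even_if_odd_part_in_lcs_2:
  assumes nil: nilpotent and o: "L 1 \<subseteq> lcs 2"
  shows "L 1 = {0}"
proof -
  have "L 1 \<subseteq> lcs (Suc k)" for k
  proof (induct k)
    case 0
    then show ?case by simp
  next
    case (Suc k)
    show ?case
    proof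
      fix v assume v: "v \<in> L 1"
      then have "v \<in> span {br a b | a b. a \<in> lcs (Suc 0)}"
        using o lcs_Suc[of "Suc 0"] by (auto simp: numeral_2_eq_2)
      then have "\<exists>e\<in>L 0. v - e \<in> lcs (Suc (Suc k))"
      proof (induct rule: span_induct_alt)
        case base
        show ?case using subspace_0[OF subspace_L] by (intro bexI[of _ 0]) auto
      next
        case (step c g w)
        then obtain a b where g: "g = br a b" by blast
        obtain a0 a1 where a: "a0 \<in> L 0" "a1 \<in> L 1" "a = a0 + a1" using L_sum by blast
        obtain b0 b1 where b: "b0 \<in> L 0" "b1 \<in> L 1" "b = b0 + b1" using L_sum by blast
        obtain e where e: "e \<in> L 0" "w - e \<in> lcs (Suc (Suc k))" using step by blast
        have 1: "br a1 b0 \<in> lcs (Suc (Suc k))" using a(2) Suc br_lcs[of "Suc k" a1 b0] by auto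
        have 2: "br a0 b1 \<in> lcs (Suc (Suc k))"
          using b(2) Suc br_lcs_lcs[of 1 "Suc k" a0 b1] by auto
        let ?e = "scale c (br a0 b0 + br a1 b1) + e"
        have "?e \<in> L 0"
          using a b e by (intro subspace_add[OF subspace_L] subspace_scale[OF subspace_L]
              br_homogeneous) auto
        moreover have "scale c g + w - ?e = scale c (br a1 b0) + scale c (br a0 b1) + (w - e)"
          unfolding g a(3) b(3) br_add_left br_add_right scale_right_distrib by simp
        then have "scale c g + w - ?e \<in> lcs (Suc (Suc k))"
          using 1 2 e by (simp only:) (intro lcs_add lcs_scale)
        ultimately show ?case by blast
      qed
      then show "v \<in> lcs (Suc (Suc k))" using parity_separation(1)[of 1 0 v] v by auto
    qed
  qed
  then have all: "L 1 \<subseteq> lcs (Suc k)" for k .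
  obtain s where s: "lcs s = {0}" using nil unfolding nilpotent_def by blast
  then have "L 1 \<subseteq> {0}" using all[of s] lcs_Suc_subset[of s] by blast
  then show ?thesis using subspace_0[OF subspace_L] by auto
qed

section \<open>Even quotients joined by an odd element\<close>

text \<open>The elements \<open>f\<^sub>i = R\<^sub>a\<^sup>i f\<^sub>0\<close> represent the quotients from degree two on and alternate in parity, so
  \<open>L\<^sub>0\<close> is spanned by \<open>y\<close> and the \<open>f\<^sub>i\<close> with \<open>i\<close> even.  For \<open>u = [a, a]\<close> the Leibniz identity gives
  \<open>R\<^sub>u = 2 R\<^sub>a\<^sup>2\<close>, so the vanishing of \<open>R\<^sub>u\<^sup>n\<^sup>-\<^sup>2\<close> at \<open>f\<^sub>0\<close> cuts the chain off too early for \<open>L\<^sub>0\<close> to have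
  dimension \<open>n\<close>.\<close>

lemma alternating_chain_contradiction:
  assumes nil: nilpotent
    and y: "y \<in> L 0" and Y: "\<And>v. v \<in> L 0 \<Longrightarrow> \<exists>c. v - scale c y \<in> lcs 2"
    and a: "a \<in> L 1" and f0: "f0 \<in> L 0" "f0 \<in> lcs 2"
    and chain: "\<And>k. lcs (k + 2) \<subseteq> span (insert ((right_mult a ^^ k) f0) (lcs (k + 3)))"
    and n: "3 \<le> dim (L 0)"
    and H: "\<And>u v. u \<in> L 0 - desc_central (L 0) 2 \<Longrightarrow> v \<in> L 0 \<Longrightarrow>
      (right_mult u ^^ (dim (L 0) - 2)) v = 0"
  shows False
proof -
  define f where "f k = (right_mult a ^^ k) f0" for k
  have f_Suc: "f (Suc k) = br (f k) a" for k by (simp add: f_def right_mult_def)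
  have f_lcs: "f k \<in> lcs (k + 2)" for k
  proof (induct k)
    case 0
    show ?case using f0 by (simp add: f_def numeral_2_eq_2)
  next
    case (Suc k)
    then show ?case using br_lcs[of "k + 2" "f k" a] by (simp add: f_Suc)
  qed
  have f_par: "f (2 * k) \<in> L 0 \<and> f (Suc (2 * k)) \<in> L 1" for k
  proof (induct k)
    case 0
    show ?case using f0 a br_homogeneous by (simp add: f_def right_mult_def)
  next
    case (Suc k)
    have "f (2 * Suc k) \<in> L 0" using Suc a br_homogeneous(2)[of "f (Suc (2 * k))" a]
      by (simp add: f_Suc)
    then show ?case using a br_homogeneous(3) by (simp add: f_Suc)
  qed
  have ch: "\<exists>c. v - scale c (f k) \<in> lcs (k + 3)" if "v \<in> lcs (k + 2)" for v k
    using chain[of k] that in_span_insert_lcs unfolding f_def by blast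
  have span: "\<exists>s\<in>span (insert y ((\<lambda>i. f (2 * i)) ` {..<q})). v - s \<in> lcs (2 * q + 2)"
    if v: "v \<in> L 0" for v q
  proof (induct q)
    case 0
    obtain c where "v - scale c y \<in> lcs 2" using Y v by blast
    then show ?case by (intro bexI[of _ "scale c y"]) (auto simp: numeral_2_eq_2 intro: span_scale span_base)
  next
    case (Suc q)
    let ?S = "\<lambda>q. insert y ((\<lambda>i. f (2 * i)) ` {..<q})"
    obtain s where s: "s \<in> span (?S q)" "v - s \<in> lcs (2 * q + 2)" using Suc by blast
    have "span (?S q) \<subseteq> L 0" by (rule span_minimal) (use y f_par subspace_L in auto)
    then have sL: "s \<in> L 0" using s by blast
    obtain c where c: "v - s - scale c (f (2 * q)) \<in> lcs (2 * q + 3)" using ch[OF s(2)] by blast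
    let ?v = "v - s - scale c (f (2 * q))"
    have vL: "?v \<in> L 0"
      using v sL f_par by (intro subspace_diff[OF subspace_L] subspace_scale[OF subspace_L]) auto
    obtain d where d: "?v - scale d (f (Suc (2 * q))) \<in> lcs (2 * q + 4)"
      using ch[of ?v "Suc (2 * q)"] c by (auto simp: eval_nat_numeral)
    have "?v \<in> lcs (2 * q + 4)"
      by (rule parity_separation(1)[OF _ _ _ vL _ d, of 1])
        (use f_par in \<open>auto intro: subspace_scale[OF subspace_L]\<close>)
    moreover have "span (?S q) \<subseteq> span (?S (Suc q))"
      by (intro span_mono insert_mono image_mono) auto
    then have "s + scale c (f (2 * q)) \<in> span (?S (Suc q))"
      using s(1) by (intro span_add span_scale) (auto intro: span_base)
    ultimately show ?case
      by (intro bexI[of _ "s + scale c (f (2 * q))"]) (simp_all add: diff_diff_eq eval_nat_numeral)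
  qed
  have bound: "dim (L 0) \<le> Suc q" if "lcs (2 * q + 2) = {0}" for q
  proof -
    have "L 0 \<subseteq> span (insert y ((\<lambda>i. f (2 * i)) ` {..<q}))"
      using span[of _ q] that by fastforce
    then have "dim (L 0) \<le> card (insert y ((\<lambda>i. f (2 * i)) ` {..<q}))"
      by (rule dim_le_card) simp
    also have "\<dots> \<le> Suc (card ((\<lambda>i. f (2 * i)) ` {..<q}))" by (rule card_insert_le_m1) simp_all
    also have "\<dots> \<le> Suc q" using card_image_le[of "{..<q}"] by simp
    finally show ?thesis .
  qed
  have vanish: "lcs (k + 2) = {0}" if "f k \<in> lcs (k + 3)" for k
    using lcs_stationary_zero[OF nil, of "k + 2"] chain[of k] that
    by (simp add: f_def[symmetric] insert_absorb eval_nat_numeral)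
  define u where "u = br a a"
  have uL: "u \<in> L 0" unfolding u_def using a br_homogeneous(2) by blast
  have Ru: "br v u = scale 2 (br (br v a) a)" for v
    unfolding u_def leibniz_odd[OF a a] using scale_left_distrib[of 1 1] by simp
  have Ru_pow: "(right_mult u ^^ j) (f k) = scale (2 ^ j) (f (k + 2 * j))" for j k
    by (induct j) (simp_all add: right_mult_def Ru br_scale_left f_Suc mult.commute)
  \<comment> \<open>\<open>[L\<^sub>0, L\<^sub>0]\<close> is spanned modulo \<open>L\<^sup>3\<close> by \<open>[y, y]\<close>, and \<open>[f\<^sub>0, [y, y]] = 0\<close>.  If \<open>u\<close> were
    in \<open>[L\<^sub>0, L\<^sub>0]\<close> then \<open>2 f\<^sub>2 = [f\<^sub>0, u]\<close> would lie one degree deeper than it should, which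
    stops the chain and leaves \<open>n \<le> 2\<close>.\<close>
  have uni: "u \<notin> desc_central (L 0) 2"
  proof
    assume u: "u \<in> desc_central (L 0) 2"
    have gens: "br p q \<in> span (insert (br y y) (lcs 3))" if "p \<in> L 0" "q \<in> L 0" for p q
    proof -
      obtain c where c: "p - scale c y \<in> lcs 2" (is "?p \<in> _") using Y \<open>p \<in> L 0\<close> by blast
      obtain d where d: "q - scale d y \<in> lcs 2" (is "?q \<in> _") using Y \<open>q \<in> L 0\<close> by blast
      have "br p q - scale (c * d) (br y y) = br ?p q + scale c (br y ?q)"
        by (simp add: br_diff_left br_diff_right br_scale_left br_scale_right
            scale_right_diff_distrib)
      moreover have "br ?p q \<in> lcs 3" using br_lcs[of 2 ?p q] c by (simp add: eval_nat_numeral)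
      moreover have "br y ?q \<in> lcs 3" using br_lcs_lcs[of 1 2 y ?q] d by (simp add: eval_nat_numeral)
      ultimately have "br p q - scale (c * d) (br y y) \<in> lcs 3" by (simp add: lcs_add lcs_scale)
      then show ?thesis using in_span_insert_lcs by blast
    qed
    have "desc_central (L 0) 2 = span {br p q | p q. p \<in> L 0 \<and> q \<in> L 0}"
      by (simp add: desc_central_def bracket_span_def)
    also have "\<dots> \<subseteq> span (insert (br y y) (lcs 3))"
      by (rule span_minimal) (use gens in auto)
    finally have "desc_central (L 0) 2 \<subseteq> span (insert (br y y) (lcs 3))" .
    then obtain c where c: "u - scale c (br y y) \<in> lcs 3" using u in_span_insert_lcs by blast
    have "br f0 (br y y) = 0" using leibniz_even_left[OF y y] by simp
    then have "br f0 u = br f0 (u - scale c (br y y))"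
      by (simp add: br_diff_right br_scale_right)
    then have "br f0 u \<in> lcs 5" using br_lcs_lcs[of 2 3 f0, OF _ _ f0(2) c] by simp
    moreover have "br f0 u = scale 2 (f 2)"
      unfolding Ru by (simp add: f_def right_mult_def numeral_2_eq_2)
    ultimately have "f 2 \<in> lcs 5" using lcs_scale_iff[of 2] by simp
    then have "lcs (2 * 1 + 2) = {0}" using vanish[of 2] by simp
    then show False using bound[of 1] n by simp
  qed
  let ?q = "dim (L 0) - 2"
  have "(right_mult u ^^ ?q) (f 0) = 0" by (rule H) (use uL uni f0 in \<open>auto simp: f_def\<close>)
  then have "f (2 * ?q) = 0" unfolding Ru_pow by simp
  then have "lcs (2 * ?q + 2) = {0}" by (intro vanish) simp
  then show False using bound[of ?q] n by simp
qed


lemma right_mult_funpow_Suc: "(right_mult a ^^ Suc k) v = br ((right_mult a ^^ k) v) a"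
  by (simp add: right_mult_def)

lemma eq_zero_if_in_all_lcs:
  assumes nilpotent "\<And>k. v \<in> lcs (k + 2)"
  shows "v = 0"
proof -
  obtain s where "lcs s = {0}" using assms(1) unfolding nilpotent_def by blast
  then show ?thesis using lcs_mono_mem[OF assms(2)[of s], of s] by simp
qed

text \<open>The commutator of \<open>R\<^sub>x\<close> and \<open>R\<^sub>y\<close> is \<open>R\<close> of the bracket \<open>[x, y]\<close>, which raises the degree by three
  under the hypothesis, instead of by two.\<close>

lemma commuting_right_mults:
  assumes x: "x \<in> L 1" and y: "y \<in> L 0" and xy: "br x y \<in> lcs 3"
    and k: "1 \<le> k" and v: "v \<in> lcs k"
  shows "br (br v x) y - br (br v y) x \<in> lcs (k + 3)"
  using leibniz_even_right[OF x y, of v] br_lcs_lcs[OF k _ v xy] by simp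

lemma odd_square_vanishes:
  assumes x: "x \<in> L 1" and xx: "br x x \<in> lcs 3" and k: "1 \<le> k" and v: "v \<in> lcs k"
  shows "br (br v x) x \<in> lcs (k + 3)"
proof -
  have "br v (br x x) = scale 2 (br (br v x) x)"
    using leibniz_odd[OF x x, of v] scale_left_distrib[of 1 1] by simp
  then show ?thesis using br_lcs_lcs[OF k _ v xx] lcs_scale_iff[of 2] by simp
qed

text \<open>With one odd generator \<open>x\<close> every quotient is represented by an iterated product of \<open>x\<close> with itself.\<close>

lemma one_odd_generator:
  assumes nil: nilpotent and x: "x \<in> L 1"
    and gen: "\<And>v. \<exists>c. v - scale c x \<in> lcs 2"
    and n: "3 \<le> dim (L 0)"
    and H: "\<And>u v. u \<in> L 0 - desc_central (L 0) 2 \<Longrightarrow> v \<in> L 0 \<Longrightarrow>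
      (right_mult u ^^ (dim (L 0) - 2)) v = 0"
  shows False
proof (rule alternating_chain_contradiction[OF nil _ _ x _ _ _ n H])
  have gen': "\<exists>c d. v - scale c x - scale d x \<in> lcs 2" for v
    using gen[of v] by (metis diff_zero scale_zero_left)
  show "0 \<in> L 0" by (rule subspace_0[OF subspace_L]) simp
  show "\<exists>c. v - scale c 0 \<in> lcs 2" if v: "v \<in> L 0" for v
  proof -
    obtain c where c: "v - scale c x \<in> lcs 2" using gen by blast
    have "v \<in> lcs 2"
      by (rule parity_separation(1)[OF _ _ _ v _ c, of 1]) (use x subspace_scale[OF subspace_L] in auto)
    then show ?thesis by simp
  qed
  show "br x x \<in> L 0" by (rule br_homogeneous(2)[OF x x])
  show "br x x \<in> lcs 2" using br_lcs[of 1 x x] by (simp add: numeral_2_eq_2)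
  show "lcs (k + 2) \<subseteq> span (insert ((right_mult x ^^ k) (br x x)) (lcs (k + 3)))" for k
  proof (induct k)
    case 0
    show ?case using lcs_2_generators[OF gen'] by simp (simp add: eval_nat_numeral)
  next
    case (Suc k)
    show ?case using lcs_Suc_generators[OF gen', of "k + 2" "(right_mult x ^^ k) (br x x)"] Suc
      by (simp add: eval_nat_numeral right_mult_funpow_Suc del: funpow.simps(2))
  qed
qed

text \<open>Each bracket with a generator changes the parity, so the quotients alternate.  On a given quotient,
  right multiplication by \<open>x + t y\<close> fails to reach the next quotient for at most one scalar \<open>t\<close>; as
  there are finitely many nonzero quotients, some \<open>t\<close> works for all of them.\<close>

lemma two_odd_generators:
  assumes nil: nilpotent and thin: thin and x: "x \<in> L 1" and y: "y \<in> L 1"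
    and gen: "\<And>v. \<exists>c d. v - scale c x - scale d y \<in> lcs 2"
    and n: "3 \<le> dim (L 0)"
    and H: "\<And>u v. u \<in> L 0 - desc_central (L 0) 2 \<Longrightarrow> v \<in> L 0 \<Longrightarrow>
      (right_mult u ^^ (dim (L 0) - 2)) v = 0"
  shows False
proof -
  have lcs2: "br a b \<in> lcs 2" for a b using br_lcs[of 1 a b] by (simp add: numeral_2_eq_2)
  have "\<exists>f0\<in>L 0 \<inter> lcs 2. lcs 2 \<subseteq> span (insert f0 (lcs 3))"
  proof (cases "{br x x, br x y, br y x, br y y} \<subseteq> lcs 3")
    case True
    then have "lcs 2 \<subseteq> lcs 3"
      using lcs_2_generators[OF gen] by (simp add: insert_absorb)
    then show ?thesis using subspace_0[OF subspace_L] by (intro bexI[of _ 0]) (auto simp: insert_absorb)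
  next
    case False
    then obtain g where "g \<in> {br x x, br x y, br y x, br y y}" "g \<notin> lcs 3" by blast
    moreover from this have "g \<in> L 0" "g \<in> lcs 2" using x y br_homogeneous lcs2 by auto
    ultimately show ?thesis using thinD[OF thin, of 2 g] by (auto simp: eval_nat_numeral)
  qed
  then obtain f0 where f0: "f0 \<in> L 0" "f0 \<in> lcs 2" "lcs 2 \<subseteq> span (insert f0 (lcs 3))" by blast
  obtain s where s: "lcs s = {0}" using nil unfolding nilpotent_def by blast
  have s0: "lcs k = {0}" if "s \<le> k" for k using lcs_antimono[OF that] s lcs_zero[of k] by auto
  define good where "good k a \<longleftrightarrow> (\<forall>g\<in>lcs k. lcs k \<subseteq> span (insert g (lcs (Suc k))) \<longrightarrow>
    lcs (Suc k) \<subseteq> span (insert (br g a) (lcs (Suc (Suc k)))))" for k a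
  \<comment> \<open>If two values of \<open>t\<close> failed, then \<open>R\<^sub>x\<close> and \<open>R\<^sub>y\<close> would both kill the quotient, which is
    impossible because together they generate the next one.\<close>
  have bad: "finite {t. \<not> good k (x + scale t y)}" if k: "2 \<le> k" for k
  proof -
    have uniq: "t = t'" if t: "\<not> good k (x + scale t y)" and t': "\<not> good k (x + scale t' y)" for t t'
    proof (rule ccontr)
      assume ne: "t \<noteq> t'"
      obtain g where g: "g \<in> lcs k" "lcs k \<subseteq> span (insert g (lcs (Suc k)))"
        and ng: "\<not> lcs (Suc k) \<subseteq> span (insert (br g (x + scale t y)) (lcs (Suc (Suc k))))"
        using t unfolding good_def by blast
      obtain g' where g': "g' \<in> lcs k" "lcs k \<subseteq> span (insert g' (lcs (Suc k)))"
        and ng': "\<not> lcs (Suc k) \<subseteq> span (insert (br g' (x + scale t' y)) (lcs (Suc (Suc k))))"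
        using t' unfolding good_def by blast
      have m: "br g (x + scale t y) \<in> lcs (Suc (Suc k))"
        using thinD[OF thin, of "Suc k"] ng br_lcs[of k g] g k by auto
      have m': "br g' (x + scale t' y) \<in> lcs (Suc (Suc k))"
        using thinD[OF thin, of "Suc k"] ng' br_lcs[of k g'] g' k by auto
      obtain c where c: "g - scale c g' \<in> lcs (Suc k)" using g(1) g'(2) in_span_insert_lcs by blast
      have "br g (x + scale t' y) = br (g - scale c g') (x + scale t' y)
          + scale c (br g' (x + scale t' y))"
        by (simp add: br_diff_left br_scale_left)
      then have m'': "br g (x + scale t' y) \<in> lcs (Suc (Suc k))"
        using m' br_lcs[of "Suc k", OF _ c] by (simp add: lcs_add lcs_scale)
      have "scale (t - t') (br g y) = br g (x + scale t y) - br g (x + scale t' y)"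
        by (simp add: br_add_right br_scale_right scale_left_diff_distrib)
      then have gy: "br g y \<in> lcs (Suc (Suc k))"
        using lcs_diff[OF m m''] lcs_scale_iff[of "t - t'" "br g y"] ne by (metis eq_iff_diff_eq_0)
      have "br g x = br g (x + scale t y) - scale t (br g y)"
        by (simp add: br_add_right br_scale_right)
      then have gx: "br g x \<in> lcs (Suc (Suc k))" using m gy by (simp add: lcs_diff lcs_scale)
      have "lcs (Suc k) \<subseteq> lcs (Suc (Suc k))"
        using lcs_Suc_generators[OF gen _ g(2)] gx gy k by (simp add: insert_absorb)
      then show False using ng span_mono[of "lcs (Suc (Suc k))"] by (auto intro: span_base)
    qed
    show ?thesis
    proof (cases "\<exists>t. \<not> good k (x + scale t y)")
      case True
      then obtain t where "\<not> good k (x + scale t y)" by blast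
      then have "{t. \<not> good k (x + scale t y)} \<subseteq> {t}" using uniq by blast
      then show ?thesis by (rule finite_subset) simp
    qed simp
  qed
  have "finite (\<Union>k\<in>{2..s}. {t. \<not> good k (x + scale t y)})" using bad by simp
  then obtain t where t: "t \<notin> (\<Union>k\<in>{2..s}. {t. \<not> good k (x + scale t y)})"
    using ex_new_if_finite[OF infinite_UNIV_char_0] by blast
  define a where "a = x + scale t y"
  have good: "good k a" if "2 \<le> k" for k
  proof (cases "k \<le> s")
    case True
    then show ?thesis using t that unfolding a_def by auto
  next
    case False
    then show ?thesis unfolding good_def using s0[of "Suc k"] by (auto intro: span_zero)
  qed
  have a: "a \<in> L 1" unfolding a_def
    using x y by (intro subspace_add[OF subspace_L] subspace_scale[OF subspace_L]) auto
  have f_lcs: "(right_mult a ^^ k) f0 \<in> lcs (k + 2)" for k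
  proof (induct k)
    case 0
    show ?case using f0 by (simp add: numeral_2_eq_2)
  next
    case (Suc k)
    then show ?case using br_lcs[of "k + 2" _ a] by (simp add: right_mult_funpow_Suc del: funpow.simps(2))
  qed
  show False
  proof (rule alternating_chain_contradiction[OF nil _ _ a f0(1,2) _ n H])
    show "0 \<in> L 0" by (rule subspace_0[OF subspace_L]) simp
    show "\<exists>c. v - scale c 0 \<in> lcs 2" if v: "v \<in> L 0" for v
    proof -
      obtain c d where "v - scale c x - scale d y \<in> lcs 2" using gen by blast
      then have cd: "v - (scale c x + scale d y) \<in> lcs 2" by (simp add: diff_diff_eq)
      have "v \<in> lcs 2"
        by (rule parity_separation(1)[OF _ _ _ v _ cd, of 1])
          (use x y subspace_scale[OF subspace_L] subspace_add[OF subspace_L] in auto)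
      then show ?thesis by simp
    qed
    show "lcs (k + 2) \<subseteq> span (insert ((right_mult a ^^ k) f0) (lcs (k + 3)))" for k
    proof (induct k)
      case 0
      show ?case using f0(3) by (simp add: eval_nat_numeral)
    next
      case (Suc k)
      have "lcs (Suc (k + 2)) \<subseteq> span (insert (br ((right_mult a ^^ k) f0) a) (lcs (Suc (Suc (k + 2)))))"
        using good[of "k + 2"] Suc f_lcs[of k] unfolding good_def by (simp add: eval_nat_numeral)
      then show ?case by (simp add: right_mult_funpow_Suc eval_nat_numeral del: funpow.simps(2))
    qed
  qed
qed

section \<open>An odd and an even generator\<close>

text \<open>Here \<open>[x, y]\<close> is odd while \<open>L\<^sup>2 / L\<^sup>3\<close> is even, so \<open>R\<^sub>x\<close> and \<open>R\<^sub>y\<close> commute up to higher order.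
  Whichever of them kills \<open>f\<^sub>0\<close> therefore kills the whole chain generated by the other one.  If \<open>R\<^sub>x\<close>
  does, then everything in \<open>L\<^sup>2\<close> is even and \<open>L\<^sub>1\<close> is spanned by \<open>x\<close>; if \<open>R\<^sub>y\<close> does, the chain alternates
  in parity under \<open>R\<^sub>x\<close>.\<close>

lemma mixed_generators_even_square:
  assumes nil: nilpotent and thin: thin and x: "x \<in> L 1" and y: "y \<in> L 0"
    and gen: "\<And>v. \<exists>c d. v - scale c x - scale d y \<in> lcs 2"
    and f0: "f0 \<in> L 0" "f0 \<in> lcs 2" "f0 \<notin> lcs 3"
    and n: "3 \<le> dim (L 0)" and m: "2 \<le> dim (L 1)"
    and H: "\<And>u v. u \<in> L 0 - desc_central (L 0) 2 \<Longrightarrow> v \<in> L 0 \<Longrightarrow>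
      (right_mult u ^^ (dim (L 0) - 2)) v = 0"
  shows False
proof -
  have lcs2: "br a b \<in> lcs 2" for a b using br_lcs[of 1 a b] by (simp add: numeral_2_eq_2)
  have lcs_2: "lcs 2 \<subseteq> span (insert f0 (lcs 3))"
    using thinD[OF thin, of 2 f0] f0 by (simp add: eval_nat_numeral)
  have "br x y \<in> lcs (Suc 2)"
    by (rule thin_parity[OF thin, of 2 f0 0 _ 1]) (use f0 x y lcs2 br_homogeneous in \<open>auto simp: eval_nat_numeral\<close>)
  then have xy: "br x y \<in> lcs 3" by (simp add: eval_nat_numeral)
  have comm: "br (br v x) y \<in> lcs (k + 3) \<longleftrightarrow> br (br v y) x \<in> lcs (k + 3)"
    if "1 \<le> k" "v \<in> lcs k" for k v
    using commuting_right_mults[OF x y xy that]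
      lcs_add[of "br (br v x) y - br (br v y) x" "k + 3" "br (br v y) x"]
      lcs_diff[of "br (br v x) y" "k + 3" "br (br v x) y - br (br v y) x"] by auto
  have f_lcs: "(right_mult a ^^ k) f0 \<in> lcs (k + 2)" for k a
  proof (induct k)
    case 0
    show ?case using f0 by (simp add: numeral_2_eq_2)
  next
    case (Suc k)
    then show ?case using br_lcs[of "k + 2" _ a] by (simp add: right_mult_funpow_Suc del: funpow.simps(2))
  qed
  have propagate: "lcs (k + 2) \<subseteq> span (insert ((right_mult a ^^ k) f0) (lcs (k + 3)))
      \<and> br ((right_mult a ^^ k) f0) b \<in> lcs (k + 4)"
    if ab: "(a, b) = (x, y) \<or> (a, b) = (y, x)" and b: "br f0 b \<in> lcs 4" for a b k
  proof (induct k)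
    case 0
    show ?case using lcs_2 b by (simp add: eval_nat_numeral)
  next
    case (Suc k)
    let ?f = "(right_mult a ^^ k) f0"
    have "lcs (Suc (k + 2)) \<subseteq> span (insert (br ?f x) (insert (br ?f y) (lcs (Suc (Suc (k + 2))))))"
      by (rule lcs_Suc_generators[OF gen]) (use Suc in \<open>auto simp: eval_nat_numeral\<close>)
    then have 1: "lcs (k + 3) \<subseteq> span (insert (br ?f a) (lcs (k + 4)))"
      using Suc ab by (auto simp: eval_nat_numeral insert_absorb insert_commute)
    have "br (br ?f b) a \<in> lcs (k + 2 + 3)"
      using Suc br_lcs[of "k + 4" "br ?f b" a] by (simp add: eval_nat_numeral)
    then have "br (br ?f a) b \<in> lcs (k + 2 + 3)"
      using comm[of "k + 2" ?f] f_lcs[where k=k and a=a] ab by auto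
    then show ?case using 1 by (simp add: right_mult_funpow_Suc eval_nat_numeral del: funpow.simps(2))
  qed
  show False
  proof (cases "br f0 x \<in> lcs 4")
    case True
    have f_even: "(right_mult y ^^ k) f0 \<in> L 0" for k
      by (induct k) (use f0 y br_homogeneous(1) in \<open>auto simp: right_mult_funpow_Suc simp del: funpow.simps(2)\<close>)
    have odd: "v \<in> lcs (k + 2)" if v: "v \<in> L 1" "v \<in> lcs 2" for v k
    proof (induct k)
      case 0
      show ?case using v by (simp add: numeral_2_eq_2)
    next
      case (Suc k)
      obtain c where c: "v - scale c ((right_mult y ^^ k) f0) \<in> lcs (k + 3)"
        using propagate[of y x k] True Suc in_span_insert_lcs by blast
      have "v \<in> lcs (k + 3)"
        by (rule parity_separation(1)[OF _ _ _ v(1) _ c, of 0])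
          (use f_even subspace_scale[OF subspace_L] in auto)
      then show ?case by (simp add: eval_nat_numeral)
    qed
    have "L 1 \<subseteq> span {x}"
    proof
      fix v assume v: "v \<in> L 1"
      obtain c d where cd: "v - scale c x - scale d y \<in> lcs 2" using gen by blast
      have vL: "v - scale c x \<in> L 1"
        using v x by (intro subspace_diff[OF subspace_L] subspace_scale[OF subspace_L]) auto
      have "v - scale c x \<in> lcs 2"
        by (rule parity_separation(1)[OF _ _ _ vL _ cd, of 0])
          (use y subspace_scale[OF subspace_L] in auto)
      then have "v - scale c x = 0" using eq_zero_if_in_all_lcs[OF nil] odd vL by blast
      then show "v \<in> span {x}" by (simp add: span_base span_scale)
    qed
    then have "dim (L 1) \<le> card {x}" by (rule dim_le_card) simp
    then show False using m by simp
  next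
    case False
    have "br f0 y \<in> lcs (Suc 3)"
      by (rule thin_parity[OF thin, of 3 "br f0 x" 1 _ 0])
        (use False f0 x y br_homogeneous br_lcs[of 2 f0] in \<open>auto simp: eval_nat_numeral\<close>)
    then have b: "br f0 y \<in> lcs 4" by (simp add: eval_nat_numeral)
    show False
    proof (rule alternating_chain_contradiction[OF nil y _ x f0(1,2) _ n H])
      show "\<exists>c. v - scale c y \<in> lcs 2" if v: "v \<in> L 0" for v
      proof -
        obtain c d where "v - scale c x - scale d y \<in> lcs 2" using gen by blast
        then have cd: "(v - scale d y) - scale c x \<in> lcs 2" by (simp add: algebra_simps)
        have vL: "v - scale d y \<in> L 0"
          using v y by (intro subspace_diff[OF subspace_L] subspace_scale[OF subspace_L]) auto
        have "v - scale d y \<in> lcs 2"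
          by (rule parity_separation(1)[OF _ _ _ vL _ cd, of 1])
            (use x subspace_scale[OF subspace_L] in auto)
        then show ?thesis by blast
      qed
    qed (use propagate[of x y] b in auto)
  qed
qed

text \<open>Let \<open>g\<^sub>i = R\<^sub>y\<^sup>i x\<close> and \<open>w = [g\<^sub>K, x]\<close>.  The identity \<open>[v, g\<^sub>i\<^sub>+\<^sub>1] = [[v, g\<^sub>i], y] - [[v, y], g\<^sub>i]\<close> moves
  factors \<open>y\<close> from the right to the left argument.  In total degree \<open>K + 2\<close> it shows, by the absence of
  even elements below, that \<open>[g\<^sub>K\<^sub>-\<^sub>i, g\<^sub>i]\<close> is \<open>(-1)\<^sup>i w\<close>; in degree \<open>K + 3\<close> each move then contributes
  one more multiple of \<open>[w, y]\<close>, with signs that accumulate, so \<open>[x, g\<^sub>K\<^sub>+\<^sub>1]\<close> is \<open>[w, y]\<close> times \<open>K + 1\<close> up to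
  sign.  But \<open>g\<^sub>K\<^sub>+\<^sub>1\<close> lies one degree deeper than expected, so \<open>[w, y]\<close> does as well.\<close>

lemma mixed_word_calculation:
  assumes x: "x \<in> L 1" and y: "y \<in> L 0"
    and noeven: "\<And>j. 2 \<le> j \<Longrightarrow> j < K + 2 \<Longrightarrow> L 0 \<inter> lcs j \<subseteq> lcs (Suc j)"
    and last: "(right_mult y ^^ Suc K) x \<in> lcs (K + 3)"
  shows "br (br ((right_mult y ^^ K) x) x) y \<in> lcs (K + 4)"
proof -
  define g where "g i = (right_mult y ^^ i) x" for i
  have g0: "g 0 = x" and g_Suc: "g (Suc i) = br (g i) y" for i
    by (simp_all add: g_def right_mult_funpow_Suc del: funpow.simps(2))
  have g_odd: "g i \<in> L 1" for i
    by (induct i) (use x y br_homogeneous(4) in \<open>auto simp: g0 g_Suc\<close>)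
  have g_lcs: "g i \<in> lcs (Suc i)" for i
    by (induct i) (auto simp: g0 g_Suc intro: br_lcs)
  define w where "w = br (g K) x"
  have lz: "br v (br (g i) y) = br (br v (g i)) y - br (br v y) (g i)" for v i
    by (rule leibniz_even_right[OF g_odd y]) simp
  have E: "br (g (K - i)) (g i) - scale ((-1) ^ i) w \<in> lcs (K + 3)" if "i \<le> K" for i
    using that
  proof (induct i)
    case 0
    show ?case by (simp add: w_def g0)
  next
    case (Suc i)
    let ?e = "br (g (K - Suc i)) (g i)"
    have "?e \<in> L 0" using br_homogeneous(2) g_odd by blast
    moreover have "?e \<in> lcs (K + 1)"
      using br_lcs_lcs[of "Suc (K - Suc i)" "Suc i", OF _ _ g_lcs g_lcs] Suc by simp
    ultimately have "?e \<in> lcs (K + 2)" using noeven[of "K + 1"] Suc by auto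
    then have ey: "br ?e y \<in> lcs (K + 3)"
      using br_lcs[of "K + 2" ?e y] by (simp add: eval_nat_numeral)
    have "g (K - i) = br (g (K - Suc i)) y"
      using Suc g_Suc[of "K - Suc i"] by (simp add: Suc_diff_Suc)
    then have "br (g (K - Suc i)) (g (Suc i)) = br ?e y - br (g (K - i)) (g i)"
      by (simp add: g_Suc lz)
    then have eq: "br (g (K - Suc i)) (g (Suc i)) - scale ((-1) ^ Suc i) w
        = br ?e y - (br (g (K - i)) (g i) - scale ((-1) ^ i) w)"
      by (simp add: algebra_simps)
    show ?case unfolding eq by (rule lcs_diff[OF ey Suc.hyps]) (use Suc in simp)
  qed
  have F: "br (g (Suc K - i)) (g i) + scale ((-1) ^ i * of_nat i) (br w y) \<in> lcs (K + 4)"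
    if "i \<le> Suc K" for i
    using that
  proof (induct i)
    case 0
    show ?case using br_lcs[of "K + 3" "g (Suc K)" x] last by (simp add: g_def g0 eval_nat_numeral)
  next
    case (Suc i)
    let ?e = "br (g (K - i)) (g i)"
    have ey: "br ?e y - scale ((-1) ^ i) (br w y) \<in> lcs (K + 4)"
      using br_lcs[of "K + 3", OF _ E[of i], of y] Suc
      by (simp add: br_diff_left br_scale_left eval_nat_numeral)
    have "g (Suc K - i) = br (g (K - i)) y"
      using Suc g_Suc[of "K - i"] by (simp add: Suc_diff_le)
    then have "br (g (Suc K - Suc i)) (g (Suc i)) = br ?e y - br (g (Suc K - i)) (g i)"
      by (simp add: g_Suc lz)
    then have eq: "br (g (Suc K - Suc i)) (g (Suc i)) + scale ((-1) ^ Suc i * of_nat (Suc i)) (br w y)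
        = (br ?e y - scale ((-1) ^ i) (br w y))
          - (br (g (Suc K - i)) (g i) + scale ((-1) ^ i * of_nat i) (br w y))"
      by (simp add: distrib_left scale_left_distrib algebra_simps)
    show ?case unfolding eq by (rule lcs_diff[OF ey Suc.hyps]) (use Suc in simp)
  qed
  have "br x (g (Suc K)) \<in> lcs (1 + (K + 3))"
    by (rule br_lcs_lcs) (use last in \<open>auto simp: g_def\<close>)
  then have xg: "br x (g (Suc K)) \<in> lcs (K + 4)" by (simp add: eval_nat_numeral)
  have "scale ((-1) ^ Suc K * of_nat (Suc K)) (br w y) \<in> lcs (K + 4)"
    using lcs_diff[OF F[of "Suc K"] xg] by (simp add: g0)
  moreover have "(-1) ^ Suc K * of_nat (Suc K) \<noteq> (0 :: complex)"
    by (simp del: of_nat_Suc)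
  ultimately have "br w y \<in> lcs (K + 4)" using lcs_scale_iff by blast
  then show ?thesis by (simp add: w_def g_def)
qed

text \<open>Let \<open>k\<close> be the first degree with an even element outside the next term.  Below \<open>k\<close> the chain runs
  along \<open>R\<^sub>y\<close>, and parity forces the step into degree \<open>k\<close> to be \<open>R\<^sub>x\<close>, with result \<open>w\<close>.  Both \<open>[w, x]\<close>
  and \<open>[w, y]\<close> vanish to the next order, so the sequence ends with \<open>w\<close> and \<open>L\<^sub>0\<close> is spanned by \<open>y\<close> and
  \<open>w\<close>.\<close>

lemma mixed_generators_odd_square:
  assumes nil: nilpotent and thin: thin and x: "x \<in> L 1" and y: "y \<in> L 0"
    and gen: "\<And>v. \<exists>c d. v - scale c x - scale d y \<in> lcs 2"
    and xx: "br x x \<in> lcs 3" and yy: "br y y \<in> lcs 3"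
  shows "dim (L 0) \<le> 2"
proof -
  have lcs2: "br a b \<in> lcs 2" for a b using br_lcs[of 1 a b] by (simp add: numeral_2_eq_2)
  have mod_y: "\<exists>d. v - scale d y \<in> L 0 \<inter> lcs 2" if v: "v \<in> L 0" for v
  proof -
    obtain c d where "v - scale c x - scale d y \<in> lcs 2" using gen by blast
    then have cd: "(v - scale d y) - scale c x \<in> lcs 2" by (simp add: algebra_simps)
    have vL: "v - scale d y \<in> L 0"
      using v y by (intro subspace_diff[OF subspace_L] subspace_scale[OF subspace_L]) auto
    have "v - scale d y \<in> lcs 2"
      by (rule parity_separation(1)[OF _ _ _ vL _ cd, of 1])
        (use x subspace_scale[OF subspace_L] in auto)
    then show ?thesis using vL by blast
  qed
  have bound: "dim (L 0) \<le> 2" if W: "L 0 \<inter> lcs 2 \<subseteq> span {w}" for w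
  proof -
    have "L 0 \<subseteq> span {y, w}"
    proof
      fix v assume "v \<in> L 0"
      then obtain d where "v - scale d y \<in> span {w}" using mod_y W by blast
      then show "v \<in> span {y, w}" using span_breakdown_eq[of v y "{w}"] by blast
    qed
    then have "dim (L 0) \<le> card {y, w}" by (rule dim_le_card) simp
    also have "\<dots> \<le> 2" by (simp add: card_insert_if)
    finally show ?thesis .
  qed
  define ev where "ev k \<longleftrightarrow> 2 \<le> k \<and> \<not> L 0 \<inter> lcs k \<subseteq> lcs (Suc k)" for k
  show ?thesis
  proof (cases "\<exists>k. ev k")
    case False
    have "v = 0" if v: "v \<in> L 0 \<inter> lcs 2" for v
    proof -
      have "v \<in> lcs (k + 2)" for k
      proof (induct k)
        case 0
        show ?case using v by (simp add: numeral_2_eq_2)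
      next
        case (Suc k)
        then show ?case using False v unfolding ev_def by (auto dest!: spec[of _ "k + 2"])
      qed
      then show ?thesis by (rule eq_zero_if_in_all_lcs[OF nil])
    qed
    then have "L 0 \<inter> lcs 2 \<subseteq> span {0}" by (auto simp: span_zero)
    then show ?thesis by (rule bound)
  next
    case True
    define k where "k = (LEAST k. ev k)"
    have evk: "ev k" unfolding k_def using True by (rule LeastI_ex)
    have below: "L 0 \<inter> lcs j \<subseteq> lcs (Suc j)" if "2 \<le> j" "j < k" for j
      using not_less_Least[of j ev] that unfolding k_def ev_def by blast
    obtain e where e: "e \<in> L 0" "e \<in> lcs k" "e \<notin> lcs (Suc k)" using evk unfolding ev_def by blast
    have k2: "2 \<le> k" using evk unfolding ev_def by blast
    have even_deep: "L 0 \<inter> lcs 2 \<subseteq> lcs j" if "2 \<le> j" "j \<le> k" for j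
      using that
    proof (induct j rule: dec_induct)
      case (step j)
      then show ?case using below[of j] by auto
    qed simp
    have "lcs k \<noteq> {0}" using e lcs_zero[of "Suc k"] by auto
    then have "lcs 2 \<noteq> {0}" using lcs_antimono[OF k2] lcs_zero[of k] by auto
    then have "\<not> lcs 2 \<subseteq> lcs 3"
      using lcs_stationary_zero[OF nil, of 2] by (auto simp: eval_nat_numeral)
    then have ne: "br x y \<notin> lcs 3 \<or> br y x \<notin> lcs 3"
      using lcs_2_generators[OF gen] xx yy by (auto simp: insert_absorb)
    \<comment> \<open>The squares of \<open>x\<close> and \<open>y\<close> are trivial in degree two, so a mixed product generates that degree.\<close>
    define f0 where "f0 = (if br x y \<in> lcs 3 then br y x else br x y)"
    have f0: "f0 \<in> L 1" "f0 \<in> lcs 2" "f0 \<notin> lcs 3"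
      using ne lcs2 x y br_homogeneous(3,4) unfolding f0_def by auto
    have f0_span: "lcs 2 \<subseteq> span (insert f0 (lcs 3))"
      using thinD[OF thin, of 2 f0] f0 by (simp add: eval_nat_numeral)
    have "k \<noteq> 2"
    proof
      assume "k = 2"
      then have "e \<in> lcs (Suc 2)"
        by (intro thin_parity[OF thin, of 2 f0 1 _ 0]) (use f0 e in \<open>auto simp: eval_nat_numeral\<close>)
      then show False using e \<open>k = 2\<close> by simp
    qed
    then obtain K where K: "k = Suc K + 2" using k2 by (intro that[of "k - 3"]) simp
    define f where "f i = (right_mult y ^^ i) f0" for i
    have f_Suc: "f (Suc i) = br (f i) y" for i
      by (simp add: f_def right_mult_funpow_Suc del: funpow.simps(2))
    have f_odd: "f i \<in> L 1" for i
    proof (induct i)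
      case 0
      show ?case using f0 by (simp add: f_def)
    next
      case (Suc i)
      then show ?case using y br_homogeneous(4) by (simp add: f_Suc)
    qed
    have f_lcs: "f i \<in> lcs (i + 2)" for i
    proof (induct i)
      case 0
      show ?case using f0 by (simp add: f_def numeral_2_eq_2)
    next
      case (Suc i)
      then show ?case using br_lcs[of "i + 2" _ y] by (simp add: f_Suc)
    qed
    have step: "lcs (i + 3) \<subseteq> span (insert (br (f i) x) (insert (f (Suc i)) (lcs (i + 4))))"
      if "lcs (i + 2) \<subseteq> span (insert (f i) (lcs (i + 3)))" for i
      using lcs_Suc_generators[OF gen, of "i + 2" "f i"] that by (simp add: f_Suc eval_nat_numeral)
    have f_span: "lcs (i + 2) \<subseteq> span (insert (f i) (lcs (i + 3)))" if "i \<le> K" for i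
      using that
    proof (induct i)
      case 0
      show ?case using f0_span by (simp add: f_def eval_nat_numeral)
    next
      case (Suc i)
      have "br (f i) x \<in> L 0" using f_odd x br_homogeneous(2) by blast
      moreover have "br (f i) x \<in> lcs (i + 3)"
        using br_lcs[of "i + 2" "f i" x] f_lcs[of i] by (simp add: eval_nat_numeral)
      ultimately have "br (f i) x \<in> lcs (i + 4)"
        using below[of "i + 3"] Suc K by (auto simp: eval_nat_numeral)
      then have "lcs (i + 3) \<subseteq> span (insert (f (Suc i)) (lcs (i + 4)))"
        using step[of i] Suc by (simp add: insert_absorb insert_commute)
      then show ?case by (simp add: eval_nat_numeral)
    qed
    define w where "w = br (f K) x"
    have w_lcs: "w \<in> lcs (K + 3)"
      unfolding w_def using br_lcs[of "K + 2" "f K" x] f_lcs[of K] by (simp add: eval_nat_numeral)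
    have k3: "k = K + 3" using K by simp
    have "f (Suc K) \<in> lcs (Suc k)"
      by (rule thin_parity[OF thin k2 e(2,3,1), of _ 1])
        (use f_lcs[of "Suc K"] f_odd k3 in \<open>auto simp: eval_nat_numeral\<close>)
    then have f_last: "f (Suc K) \<in> lcs (K + 4)" using k3 by (simp add: eval_nat_numeral)
    have w_span: "lcs (K + 3) \<subseteq> span (insert w (lcs (K + 4)))"
      using step[OF f_span[of K]] f_last by (simp add: w_def insert_absorb)
    have wx: "br w x \<in> lcs (K + 5)"
      using odd_square_vanishes[OF x xx _ f_lcs[of K]] by (simp add: w_def eval_nat_numeral)
    \<comment> \<open>If \<open>[x, y]\<close> lies in \<open>L\<^sup>3\<close>, the chain starts at \<open>[y, x]\<close> and the right multiplications
      commute up to higher order; otherwise it starts at \<open>[x, y]\<close>, that is, it is \<open>R\<^sub>y\<^sup>i x\<close>.\<close>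
    have wy: "br w y \<in> lcs (K + 5)"
    proof (cases "br x y \<in> lcs 3")
      case True
      have 1: "br (br (f K) x) y - br (br (f K) y) x \<in> lcs (K + 5)"
        using commuting_right_mults[OF x y True _ f_lcs[of K]] by (simp add: eval_nat_numeral)
      have 2: "br (br (f K) y) x \<in> lcs (K + 5)"
        using br_lcs[of "K + 4" "f (Suc K)" x] f_last by (simp add: f_Suc eval_nat_numeral)
      show ?thesis using lcs_add[OF 1 2] by (simp add: w_def)
    next
      case False
      have fx: "f i = (right_mult y ^^ Suc i) x" for i
        using False by (simp add: f_def f0_def funpow_Suc_right right_mult_def del: funpow.simps(2))
      have "br (br ((right_mult y ^^ Suc K) x) x) y \<in> lcs (Suc K + 4)"
      proof (rule mixed_word_calculation[OF x y])
        show "L 0 \<inter> lcs j \<subseteq> lcs (Suc j)" if "2 \<le> j" "j < Suc K + 2" for j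
          using below that K by simp
        show "(right_mult y ^^ Suc (Suc K)) x \<in> lcs (Suc K + 3)"
          using f_last unfolding fx by (simp add: eval_nat_numeral)
      qed
      then show ?thesis unfolding w_def fx by (simp add: eval_nat_numeral)
    qed
    have "lcs (K + 4) \<subseteq> span (insert (br w x) (insert (br w y) (lcs (K + 5))))"
      using lcs_Suc_generators[OF gen, of "K + 3" w] w_span by (simp add: eval_nat_numeral)
    then have "lcs (K + 4) \<subseteq> lcs (Suc (K + 4))"
      using wx wy by (simp add: insert_absorb eval_nat_numeral)
    then have "lcs (K + 4) = {0}" by (intro lcs_stationary_zero[OF nil]) simp
    then have "lcs k \<subseteq> span {w}"
      using w_span k3 by (simp add: insert_commute)
    then show ?thesis using bound even_deep[OF k2 order_refl] by blast
  qed
qed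

section \<open>The bound on the nilindex\<close>

lemma nilindex_less:
  assumes nil: nilpotent
    and n: "3 \<le> dim (L 0)" and m: "2 \<le> dim (L 1)"
    and H: "\<And>u v. u \<in> L 0 - desc_central (L 0) 2 \<Longrightarrow> v \<in> L 0 \<Longrightarrow>
      (right_mult u ^^ (dim (L 0) - 2)) v = 0"
  shows "nilindex < dim (L 0) + dim (L 1)"
proof (rule ccontr)
  define N where "N = dim (L 0) + dim (L 1)"
  assume "\<not> nilindex < dim (L 0) + dim (L 1)"
  then have N: "N \<le> nilindex" unfolding N_def by simp
  have "\<not> L 1 \<subseteq> lcs 2"
    using even_if_odd_part_in_lcs_2[OF nil] m dim_le_card[of "L 1" "{}"] by auto
  then obtain x where x: "x \<in> L 1" "x \<notin> lcs 2" by blast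
  show False
  proof (cases "\<forall>v. v \<in> span (insert x (lcs 2))")
    case True
    then have "\<exists>c. v - scale c x \<in> lcs 2" for v using in_span_insert_lcs by blast
    then show False using one_odd_generator[OF nil x(1) _ n H] by blast
  next
    case False
    have "\<exists>p\<in>{0,1}. \<exists>y\<in>L p. y \<notin> span (insert x (lcs 2))"
    proof (rule ccontr)
      assume "\<not> ?thesis"
      then have "L 0 \<subseteq> span (insert x (lcs 2))" "L 1 \<subseteq> span (insert x (lcs 2))" by auto
      then have "v \<in> span (insert x (lcs 2))" for v using L_sum[of v] by (auto intro: span_add)
      then show False using False by blast
    qed
    then obtain p y where y: "p \<in> {0, 1}" "y \<in> L p" "y \<notin> span (insert x (lcs 2))" by blast
    have xs: "x \<notin> span (lcs 2)" using x by simp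
    have d2: "dim (insert y (insert x (lcs 2))) = dim (lcs 2) + 2" by (rule dim_insert2[OF xs y(3)])
    have d2_le: "dim (lcs 2) + 2 \<le> N"
      using d2 dim_mono_subset[of "insert y (insert x (lcs 2))" UNIV] dim_UNIV_le
      unfolding N_def by simp
    have thin: thin by (rule thin_if_large_nilindex[OF nil N d2_le])
    have gen: "\<exists>c d. v - scale c x - scale d y \<in> lcs 2" for v
    proof -
      obtain C where "finite_dimensional_vector_space scale C" using finite_dimensional_basis by blast
      then interpret fd: finite_dimensional_vector_space scale C .
      have "v \<in> span (insert y (insert x (lcs 2)))"
      proof (rule ccontr)
        assume "v \<notin> span (insert y (insert x (lcs 2)))"
        then have "dim (insert v (insert y (insert x (lcs 2)))) = dim (lcs 2) + 3"
          using d2 by (simp add: fd.dim_insert)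
        moreover have "dim (insert v (insert y (insert x (lcs 2)))) \<le> dim UNIV"
          by (rule dim_mono_subset) simp
        moreover have "N \<le> 2 + dim (lcs 2)" by (rule dim_lcs_lower[OF nil N]) simp
        ultimately show False using dim_UNIV_le unfolding N_def by simp
      qed
      then obtain d where "v - scale d y \<in> span (insert x (lcs 2))"
        using span_breakdown_eq by blast
      then obtain c where "v - scale d y - scale c x \<in> lcs 2" using in_span_insert_lcs by blast
      then have "v - scale c x - scale d y \<in> lcs 2" by (simp add: algebra_simps)
      then show ?thesis by blast
    qed
    show False
    proof (cases "p = 1")
      case True
      then show False using two_odd_generators[OF nil thin x(1) _ gen n H] y by blast
    next
      case p: False
      then have y0: "y \<in> L 0" using y by auto
      show False
      proof (cases "br x x \<in> lcs 3 \<and> br y y \<in> lcs 3")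
        case True
        then show False using mixed_generators_odd_square[OF nil thin x(1) y0 gen] n by simp
      next
        case False
        have sq: "br x x \<in> L 0" "br y y \<in> L 0" using x y0 br_homogeneous by auto
        have sq2: "br a a \<in> lcs 2" for a using br_lcs[of 1 a a] by (simp add: numeral_2_eq_2)
        show False
          using False mixed_generators_even_square[OF nil thin x(1) y0 gen _ _ _ n m H] sq sq2
          by blast
      qed
    qed
  qed
qed

end

theorem mainTheorem1:
  fixes scale :: "complex \<Rightarrow> 'a::ab_group_add \<Rightarrow> 'a"
    and L :: "nat \<Rightarrow> 'a set"
    and br :: "'a \<Rightarrow> 'a \<Rightarrow> 'a"
    and n m n1 m1 :: nat
    and ns ms :: "nat list"
  assumes "leibniz_superalgebra scale L br"
    and "leibniz_superalgebra.nilpotent scale br"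
    and "vector_space.dim scale (L 0) = n"
    and "vector_space.dim scale (L 1) = m"
    and "leibniz_superalgebra.has_char_seq scale L br (n1 # ns) (m1 # ms)"
    and "int n1 \<le> int n - 2"
    and "int m1 \<le> int m - 1"
  shows "leibniz_superalgebra.nilindex scale br < n + m"
proof -
  interpret leibniz_superalgebra scale L br by (rule assms(1))
  note nil = assms(2)
  have max: "is_lex_max (n1 # ns) (block_sequences 0)" "is_lex_max (m1 # ms) (block_sequences 1)"
    using assms(5) unfolding has_char_seq_def by auto
  have pos: "0 < n1" "0 < m1"
    using max block_sequence_pos unfolding is_lex_max_def by blast+
  obtain s where s: "lcs s = {0}" using nil unfolding nilpotent_def by blast
  have pow: "(right_mult u ^^ M) v \<in> lcs (Suc M)" for u v M
  proof (induct M)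
    case (Suc M)
    then show ?case using br_lcs[of "Suc M"] by (simp add: right_mult_funpow_Suc del: funpow.simps(2))
  qed simp
  have nilpow: "(right_mult u ^^ s) v = 0" for u v
    using pow[of s u v] lcs_Suc_subset[of s] s by blast
  have "(right_mult u ^^ (dim (L 0) - 2)) v = 0"
    if u: "u \<in> L 0 - desc_central (L 0) 2" and v: "v \<in> L 0" for u v
  proof -
    have z: "(right_mult u ^^ n1) v = 0"
      by (rule pow_first_block_zero[OF _ max(1) u nilpow v]) simp
    have "dim (L 0) - 2 = (dim (L 0) - 2 - n1) + n1" using assms(3,6) by simp
    then have "(right_mult u ^^ (dim (L 0) - 2)) v = (right_mult u ^^ (dim (L 0) - 2 - n1)) 0"
      using z by (metis comp_apply funpow_add)
    also have "(right_mult u ^^ j) 0 = 0" for j by (induct j) (simp_all add: right_mult_def)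
    finally show ?thesis .
  qed
  then have "nilindex < dim (L 0) + dim (L 1)"
    by (intro nilindex_less[OF nil]) (use assms(3,4,6,7) pos in auto)
  then show ?thesis using assms(3,4) by simp
qed

end
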